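(* Let $k$ be a field and $G$ a finite group. Let $\mathcal D^*(kG,kG)=\bigoplus_{x\in X}\widehat{\mathcal H}_x^*$ be the decomposition of the Tate-Hochschild cochain complex, with its cyclic $A_\infty$-algebra structure $(\langle\cdot,\cdot\rangle,\ m_1=\partial',\ m_2=\cup,\ m_3,\ m_i=0\ (i>3))$. Regard the Tate cochain complex $\widehat C^*(G,k)$ as a subcomplex of $\mathcal D^*(kG,kG)$ through the injection $\widehat\iota_{x=1}$, whose image is $\widehat{\mathcal H}_1^*$. Then $\widehat C^*(G,k)$ is a cyclic $A_\infty$-subalgebra of $\mathcal D^*(kG,kG)$ (that is, $\widehat{\mathcal H}_1^*$ is closed under all $m_i$, and becomes a cyclic $A_\infty$-algebra with the restricted operations and the restricted non-degenerate pairing). Moreover, for each $x\in X$, $\widehat{\mathcal H}_x^*$ is an $A_\infty$-module over $\widehat C^*(G,k)$, with structure maps the restrictions of the $m_i$ (that is, $m_i(\alpha_1,\dots,\alpha_{i-1},\xi)\in\widehat{\mathcal H}_x^*$ for $\alpha_1,\dots,\alpha_{i-1}\in\widehat{\mathcal H}_1^*$, $\xi\in\widehat{\mathcal H}_x^*$).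
   Context: Notation. $\overline G=G\setminus\{1\}$; $g_{i,j}$ denotes the sequence $g_i,g_{i+1},\dots,g_j$ (empty if $j<i$). $C^n(kG,kG)=\mathrm{Map}(\overline G^{\times n},kG)$ and $C_n(kG,kG)=k[G\times\overline G^{\times n}]$ for $n\ge0$ (normalized Hochschild cochains/chains). Cochains are extended by $0$ to tuples having an entry equal to $1$; a chain $(g_0,g_{1,n})$ with some $g_i=1$, $i\ge1$, is $0$; chains are extended linearly in the first entry to elements of $kG$. The Hochschild differentials are $\delta(\varphi)(g_{1,n+1})=g_1\varphi(g_{2,n+1})+\sum_{i=1}^n(-1)^i\varphi(g_{1,i-1},g_ig_{i+1},g_{i+2,n+1})+(-1)^{n+1}\varphi(g_{1,n})g_{n+1}$ and $\partial_n(g_0,g_{1,n})=(g_0g_1,g_{2,n})+\sum_{i=1}^{n-1}(-1)^i(g_0,g_{1,i-1},g_ig_{i+1},g_{i+2,n})+(-1)^n(g_ng_0,g_{1,n-1})$. The Tate-Hochschild cochain complex: $\mathcal D^m(kG,kG)=C^m(kG,kG)$ for $m\ge0$ and $\mathcal D^{-p-1}(kG,kG)=C_p(kG,kG)$ for $p\ge0$. Its differential $\partial'$ (degree $+1$) is $\delta$ on $\mathcal D^{\ge0}$, $(-1)^{p}\partial_p$ on $\mathcal D^{-p-1}=C_p$ for $p\ge1$, and $\tau:C_0=kG\to C^0=kG$, $\tau(h)=\sum_{g\in G}ghg^{-1}$ in degree $-1$. Write $|\alpha|$ for the degree in $\mathcal D^*$. Pairing: on $kG$, $\langle g,h\rangle=1$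 if $gh=1$ and $0$ otherwise $(g,h\in G)$. On $\mathcal D^*(kG,kG)$: for $\alpha\in C^m$, $\beta=(g_0,g_{1,n})\in C_n$, $\langle\alpha,\beta\rangle=\langle\beta,\alpha\rangle=\langle\alpha(g_{1,n}),g_0\rangle$ if $m=n$, and $0$ otherwise; two cochains, or two chains, pair to $0$. Cup product $\cup$, $\alpha\in\mathcal D^n$, $\beta\in\mathcal D^m$: (1) $n,m\ge0$: $(\alpha\cup\beta)(g_{1,n+m})=\alpha(g_{1,n})\beta(g_{n+1,n+m})$. (2) $\alpha=(g_0,g_{1,s})\in C_s$, $\beta=(h_0,h_{1,t})\in C_t$: $\alpha\cup\beta=\sum_{g\in G}(gh_0,h_{1,t},g^{-1}g_0,g_{1,s})\in C_{s+t+1}$. (3) $\alpha\in C^n$, $\beta=(h_0,h_{1,t})$, $n\le t$: $\alpha\cup\beta=(\alpha(h_{t-n+1,t})h_0,h_{1,t-n})\in C_{t-n}$. (4) $\alpha\in C^n$, $\beta=(g_0,g_{1,t})$, $n\ge t+1$: $(\alpha\cup\beta)(h_{1,n-t-1})=\sum_{g\in G}\alpha(h_{1,n-t-1},g^{-1},g_{1,t})g_0g$. (5) $\alpha=(g_0,g_{1,s})$, $\beta\in C^m$, $m\le s$: $\alpha\cup\beta=(g_0\beta(g_{1,m}),g_{m+1,s})\in C_{s-m}$. (6) $\alpha=(g_0,g_{1,s})$, $\beta\in C^m$, $m\ge s+1$: $(\alpha\cup\beta)(h_{1,m-s-1})=\sum_{g\in G}gg_0\beta(g_{1,s},g^{-1},h_{1,m-s-1})$.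 The operation $m_3$ (degree $-1$) is zero except in the following two cases. (iv) For $\phi\in C^m$, $\varphi\in C^n$, $\alpha=(g_0,g_{1,r})\in C_r$ with $r+2\le m+n$, $m_3(\phi,\alpha,\varphi)\in C^{m+n-r-2}$ is $$m_3(\phi,\alpha,\varphi)(h_{1,m-r+n-2})=\sum_{g\in G}\sum_j(-1)^{m+r+j-1}\phi(h_{1,m-r+j-2},g,g_{j,r})\,g_0\,\varphi(g_{1,j-1},g^{-1},h_{m-r+j-1,m-r+n-2}),$$ $j$ running over $1\le j\le\min\{n,r+1\}$ with $m-r+j-2\ge0$; if $r+2>m+n$ it is $0$. (v) For $\alpha=(g_0,g_{1,r})\in C_r$, $\beta=(h_0,h_{1,s})\in C_s$, $\phi\in C^m$ with $m-1\le r+s$, $$m_3(\alpha,\phi,\beta)=\sum_{g\in G}\sum_j(-1)^{r+s+m-j}\bigl(g_0\phi(g_{1,m-s+j-1},g,h_{j+1,s})h_0,\ h_{1,j},\ g^{-1},\ g_{m-s+j,r}\bigr)\in C_{r+s-m+2},$$ $j$ running over $0\le j\le s$ with $0\le m-s+j-1\le r$; if $m-1>r+s$ it is $0$. An $A_\infty$-algebra has operations $m_i$ of degree $2-i$ satisfying $\sum_{r+s+t=n}(-1)^{r+st}m_{r+1+t}(\mathrm{id}^{\otimes r}\otimes m_s\otimes\mathrm{id}^{\otimes t})=0$ for all $n\ge1$ (Koszul sign rule); it is cyclic if $\langle\alpha_0,m_i(\alpha_1,\dots,\alpha_i)\rangle=(-1)^{|\alpha_0|(2-i)+i}\langle m_i(\alpha_0,\dots,\alpha_{i-1}),\alpha_i\rangle$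 for the given non-degenerate pairing. It is known (Rivera–Wang) and may be assumed that $(\mathcal D^*(kG,kG),\langle\cdot,\cdot\rangle,m_1=\partial',m_2=\cup,m_3,0,\dots)$ is a cyclic $A_\infty$-algebra. Decomposition. $X$ is a set of representatives of the conjugacy classes of $G$ containing $1$, and $C_x$ is the conjugacy class of $x$. For $n,s\ge0$ put $\mathcal H_x^n=\{\varphi\in C^n(kG,kG):\varphi(g_{1,n})\in k[g_1\cdots g_nC_x]\ \forall g_i\}$ and $\mathcal H_{x,s}=k[(g_s^{-1}\cdots g_1^{-1}u,g_{1,s}):u\in C_x,\ g_i\in\overline G]\subset C_s(kG,kG)$. $\widehat{\mathcal H}_x^*$ is the subcomplex of $\mathcal D^*(kG,kG)$ with $\widehat{\mathcal H}_x^n=\mathcal H_x^n$ $(n\ge0)$ and $\widehat{\mathcal H}_x^{-s-1}=\mathcal H_{x,s}$ $(s\ge0)$. Tate cochain complex. $\widehat C^n(G,k)=\mathrm{Map}(\overline G^{\times n},k)$ for $n\ge0$ and $\widehat C^{-s-1}(G,k)=k[\overline G^{\times s}]$ for $s\ge0$ (normalized group cochains and chains with trivial coefficients, spliced in degree $-1$ by multiplication by $|G|$; the differential in negative degrees carries the same sign changes as $\partial'$). The injection $\widehat\iota_{x=1}:\widehat C^*(G,k)\to\mathcal D^*(kG,kG)$ sends $\varphi:\overline G^{\times n}\to k$ to $\bigl(g_{1,n}\mapsto\varphi(g_{1,n})g_1\cdots g_n\bigr)$, and $(g_{1,s})$ to $(g_s^{-1}\cdots g_1^{-1},g_{1,s})$;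 it is an isomorphism onto $\widehat{\mathcal H}_1^*$. *)

theory Defs
  imports Complex_Main "HOL-Algebra.Coset" "HOL-Library.Function_Algebras"
begin

section \<open>Cyclic A-infinity algebras and A-infinity modules\<close>

text \<open>
  A graded vector space is a family \<open>A :: int \<Rightarrow> 'v set\<close> of subspaces of an ambient vector space
  \<open>'v\<close> with scalar multiplication \<open>scale\<close>.  A homogeneous element is a pair \<open>(p, a)\<close> with
  \<open>a \<in> A p\<close>; operations take lists of homogeneous elements, and \<open>m i\<close> is only relevant on lists of
  length \<open>i\<close>.
\<close>

definition homog :: "(int \<Rightarrow> 'v set) \<Rightarrow> (int \<times> 'v) set" where
  "homog A = {(p, a). a \<in> A p}"

definition deg :: "(int \<times> 'v) list \<Rightarrow> int" where
  "deg xs = sum_list (map fst xs)"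

definition graded_space :: "('k::field \<Rightarrow> 'v::ab_group_add \<Rightarrow> 'v) \<Rightarrow> (int \<Rightarrow> 'v set) \<Rightarrow> bool" where
  "graded_space scale A \<longleftrightarrow> vector_space scale \<and> (\<forall>p. module.subspace scale (A p))"

definition graded_multilinear ::
  "('k::field \<Rightarrow> 'v::ab_group_add \<Rightarrow> 'v) \<Rightarrow> (int \<Rightarrow> 'v set) list \<Rightarrow> (int \<Rightarrow> 'v set) \<Rightarrow> int
    \<Rightarrow> ((int \<times> 'v) list \<Rightarrow> 'v) \<Rightarrow> bool" where
  "graded_multilinear scale As B e f \<longleftrightarrow>
     (\<forall>xs. list_all2 (\<lambda>x A. x \<in> homog A) xs As \<longrightarrow>
        f xs \<in> B (deg xs + e) \<and>
        (\<forall>i<length xs. \<forall>y \<in> (As ! i) (fst (xs ! i)). \<forall>c.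
           f (xs[i := (fst (xs ! i), snd (xs ! i) + scale c y)]) =
           f xs + scale c (f (xs[i := (fst (xs ! i), y)]))))"

text \<open>
  The term \<open>(-1)^(r+st) m\<^sub>r\<^sub>+\<^sub>1\<^sub>+\<^sub>t(id^r \<otimes> m\<^sub>s \<otimes> id^t)\<close> evaluated at homogeneous elements \<open>xs\<close>.
  Moving \<open>m\<^sub>s\<close>, of degree \<open>2 - s\<close>, past the first \<open>r\<close> arguments gives the Koszul sign
  \<open>(-1)^((2-s)(|x\<^sub>1|+...+|x\<^sub>r|))\<close>.
\<close>

definition stasheff_term ::
  "('k::field \<Rightarrow> 'v \<Rightarrow> 'v) \<Rightarrow> (nat \<Rightarrow> (int \<times> 'v) list \<Rightarrow> 'v) \<Rightarrow> (nat \<Rightarrow> (int \<times> 'v) list \<Rightarrow> 'v)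
    \<Rightarrow> nat \<Rightarrow> nat \<Rightarrow> nat \<Rightarrow> (int \<times> 'v) list \<Rightarrow> 'v" where
  "stasheff_term scale m_outer m_inner r s t xs =
     (let ys = take s (drop r xs) in
      scale ((-1) ^ (r + s * t) * (-1) powi ((2 - int s) * deg (take r xs)))
        (m_outer (r + 1 + t)
          (take r xs @ [(deg ys + (2 - int s), m_inner s ys)] @ drop (r + s) xs)))"

definition ainf_algebra ::
  "('k::field \<Rightarrow> 'v::ab_group_add \<Rightarrow> 'v) \<Rightarrow> (int \<Rightarrow> 'v set) \<Rightarrow> (nat \<Rightarrow> (int \<times> 'v) list \<Rightarrow> 'v)
    \<Rightarrow> bool" where
  "ainf_algebra scale A m \<longleftrightarrow>
     graded_space scale A \<and>
     (\<forall>i\<ge>1. graded_multilinear scale (replicate i A) A (2 - int i) (m i)) \<and>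
     (\<forall>n\<ge>1. \<forall>xs. length xs = n \<and> set xs \<subseteq> homog A \<longrightarrow>
        (\<Sum>(r, s, t) \<in> {(r, s, t). r + s + t = n \<and> 1 \<le> s}. stasheff_term scale m m r s t xs) = 0)"

definition nondegenerate_pairing ::
  "('k::field \<Rightarrow> 'v::ab_group_add \<Rightarrow> 'v) \<Rightarrow> (int \<Rightarrow> 'v set) \<Rightarrow> (int \<times> 'v \<Rightarrow> int \<times> 'v \<Rightarrow> 'k) \<Rightarrow> bool"
  where
  "nondegenerate_pairing scale A pair \<longleftrightarrow>
     (\<forall>p q. \<forall>a\<in>A p. \<forall>a'\<in>A p. \<forall>b\<in>A q. \<forall>b'\<in>A q. \<forall>c.
        pair (p, a + scale c a') (q, b) = pair (p, a) (q, b) + c * pair (p, a') (q, b) \<and>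
        pair (p, a) (q, b + scale c b') = pair (p, a) (q, b) + c * pair (p, a) (q, b')) \<and>
     (\<forall>p. \<forall>a\<in>A p. (\<forall>y\<in>homog A. pair (p, a) y = 0) \<longrightarrow> a = 0) \<and>
     (\<forall>p. \<forall>a\<in>A p. (\<forall>y\<in>homog A. pair y (p, a) = 0) \<longrightarrow> a = 0)"

text \<open>In the cyclicity condition \<open>xs\<close> is the list \<open>\<alpha>\<^sub>0, ..., \<alpha>\<^sub>i\<close>.\<close>

definition cyclic_ainf_algebra ::
  "('k::field \<Rightarrow> 'v::ab_group_add \<Rightarrow> 'v) \<Rightarrow> (int \<Rightarrow> 'v set) \<Rightarrow> (nat \<Rightarrow> (int \<times> 'v) list \<Rightarrow> 'v)
    \<Rightarrow> (int \<times> 'v \<Rightarrow> int \<times> 'v \<Rightarrow> 'k) \<Rightarrow> bool" where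
  "cyclic_ainf_algebra scale A m pair \<longleftrightarrow>
     ainf_algebra scale A m \<and> nondegenerate_pairing scale A pair \<and>
     (\<forall>i\<ge>1. \<forall>xs. length xs = i + 1 \<and> set xs \<subseteq> homog A \<longrightarrow>
        pair (hd xs) (deg (tl xs) + (2 - int i), m i (tl xs)) =
        (-1) powi (fst (hd xs) * (2 - int i) + int i) *
          pair (deg (butlast xs) + (2 - int i), m i (butlast xs)) (last xs))"

definition cyclic_ainf_subalgebra ::
  "('k::field \<Rightarrow> 'v::ab_group_add \<Rightarrow> 'v) \<Rightarrow> (int \<Rightarrow> 'v set) \<Rightarrow> (int \<Rightarrow> 'v set)
    \<Rightarrow> (nat \<Rightarrow> (int \<times> 'v) list \<Rightarrow> 'v) \<Rightarrow> (int \<times> 'v \<Rightarrow> int \<times> 'v \<Rightarrow> 'k) \<Rightarrow> bool" where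
  "cyclic_ainf_subalgebra scale B A m pair \<longleftrightarrow>
     cyclic_ainf_algebra scale A m pair \<and> (\<forall>p. B p \<subseteq> A p) \<and> cyclic_ainf_algebra scale B m pair"

text \<open>
  Left modules: \<open>mM i\<close> takes \<open>i - 1\<close> arguments from \<open>A\<close> followed by one from \<open>M\<close>.  The inner operation acts on the module element
  exactly when \<open>t = 0\<close>.
\<close>

definition ainf_module ::
  "('k::field \<Rightarrow> 'v::ab_group_add \<Rightarrow> 'v) \<Rightarrow> (int \<Rightarrow> 'v set) \<Rightarrow> (nat \<Rightarrow> (int \<times> 'v) list \<Rightarrow> 'v)
    \<Rightarrow> (int \<Rightarrow> 'v set) \<Rightarrow> (nat \<Rightarrow> (int \<times> 'v) list \<Rightarrow> 'v) \<Rightarrow> bool" where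
  "ainf_module scale A m M mM \<longleftrightarrow>
     ainf_algebra scale A m \<and> graded_space scale M \<and>
     (\<forall>i\<ge>1. graded_multilinear scale (replicate (i - 1) A @ [M]) M (2 - int i) (mM i)) \<and>
     (\<forall>n\<ge>1. \<forall>xs y. length xs = n - 1 \<and> set xs \<subseteq> homog A \<and> y \<in> homog M \<longrightarrow>
        (\<Sum>(r, s, t) \<in> {(r, s, t). r + s + t = n \<and> 1 \<le> s}.
           stasheff_term scale mM (if t = 0 then mM else m) r s t (xs @ [y])) = 0)"

definition complex_embedding ::
  "('k::field \<Rightarrow> 'u::ab_group_add \<Rightarrow> 'u) \<Rightarrow> (int \<Rightarrow> 'u set) \<Rightarrow> (int \<Rightarrow> 'u \<Rightarrow> 'u)
    \<Rightarrow> ('k \<Rightarrow> 'v::ab_group_add \<Rightarrow> 'v) \<Rightarrow> (int \<Rightarrow> 'v set) \<Rightarrow> (int \<Rightarrow> 'v \<Rightarrow> 'v)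
    \<Rightarrow> (int \<Rightarrow> 'u \<Rightarrow> 'v) \<Rightarrow> bool" where
  "complex_embedding scaleC C dC scaleD D dD f \<longleftrightarrow>
     (\<forall>p. f p ` C p \<subseteq> D p \<and> inj_on (f p) (C p) \<and>
        (\<forall>a\<in>C p. \<forall>b\<in>C p. \<forall>c. f p (a + scaleC c b) = f p a + scaleD c (f p b)) \<and>
        (\<forall>a\<in>C p. dC p a \<in> C (p + 1) \<and> f (p + 1) (dC p a) = dD p (f p a)))"


section \<open>Words, the group algebra and conjugacy classes\<close>

definition bar_words :: "('g, 'b) monoid_scheme \<Rightarrow> nat \<Rightarrow> 'g list set" where
  "bar_words G n = {w. length w = n \<and> set w \<subseteq> carrier G - {\<one>\<^bsub>G\<^esub>}}"

text \<open>\<open>seg w i j\<close> is \<open>g\<^sub>i, ..., g\<^sub>j\<close> for \<open>w = [g\<^sub>1, ..., g\<^sub>n]\<close> and \<open>i \<ge> 1\<close>; it is empty if \<open>j < i\<close>.\<close>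

definition seg :: "'g list \<Rightarrow> nat \<Rightarrow> nat \<Rightarrow> 'g list" where
  "seg w i j = take (j + 1 - i) (drop (i - 1) w)"

definition merge_at :: "('g, 'b) monoid_scheme \<Rightarrow> 'g list \<Rightarrow> nat \<Rightarrow> 'g list" where
  "merge_at G w i =
     seg w 1 (i - 1) @ [w ! (i - 1) \<otimes>\<^bsub>G\<^esub> w ! i] @ seg w (i + 2) (length w)"

definition word_prod :: "('g, 'b) monoid_scheme \<Rightarrow> 'g list \<Rightarrow> 'g" where
  "word_prod G w = foldr (\<lambda>a b. a \<otimes>\<^bsub>G\<^esub> b) w \<one>\<^bsub>G\<^esub>"

definition inv_word_prod :: "('g, 'b) monoid_scheme \<Rightarrow> 'g list \<Rightarrow> 'g" where
  "inv_word_prod G w = word_prod G (rev (map (\<lambda>a. inv\<^bsub>G\<^esub> a) w))"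

text \<open>Elements of \<open>kG\<close>, for finite \<open>G\<close>, are coefficient functions vanishing off \<open>carrier G\<close>.\<close>

definition gsingle :: "'g \<Rightarrow> 'g \<Rightarrow> 'k::field" where
  "gsingle g = (\<lambda>h. if h = g then 1 else 0)"

definition gmult :: "('g, 'b) monoid_scheme \<Rightarrow> ('g \<Rightarrow> 'k::field) \<Rightarrow> ('g \<Rightarrow> 'k) \<Rightarrow> 'g \<Rightarrow> 'k" where
  "gmult G a b =
     (\<lambda>g. \<Sum>h\<in>carrier G. \<Sum>h'\<in>carrier G. if h \<otimes>\<^bsub>G\<^esub> h' = g then a h * b h' else 0)"

definition gpair :: "('g, 'b) monoid_scheme \<Rightarrow> ('g \<Rightarrow> 'k::field) \<Rightarrow> ('g \<Rightarrow> 'k) \<Rightarrow> 'k" where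
  "gpair G a b =
     (\<Sum>g\<in>carrier G. \<Sum>h\<in>carrier G. if g \<otimes>\<^bsub>G\<^esub> h = \<one>\<^bsub>G\<^esub> then a g * b h else 0)"

definition conj_class :: "('g, 'b) monoid_scheme \<Rightarrow> 'g \<Rightarrow> 'g set" where
  "conj_class G x = {g \<otimes>\<^bsub>G\<^esub> x \<otimes>\<^bsub>G\<^esub> inv\<^bsub>G\<^esub> g | g. g \<in> carrier G}"

definition conj_reps :: "('g, 'b) monoid_scheme \<Rightarrow> 'g set \<Rightarrow> bool" where
  "conj_reps G X \<longleftrightarrow>
     X \<subseteq> carrier G \<and> \<one>\<^bsub>G\<^esub> \<in> X \<and> (\<forall>g\<in>carrier G. \<exists>!x. x \<in> X \<and> g \<in> conj_class G x)"


section \<open>The Tate-Hochschild cochain complex\<close>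

text \<open>
  Normalized cochains \<open>C\<^sup>n\<close> and chains \<open>C\<^sub>n\<close> share one type.  If \<open>f\<close> is a cochain, \<open>f w g\<close> is the
  coefficient of \<open>g\<close> in \<open>f(w) \<in> kG\<close>, and \<open>f\<close> vanishes on all words other than those of length \<open>n\<close> in
  nontrivial group elements (extension by \<open>0\<close>).  If \<open>f\<close> is a chain, \<open>f w g\<close> is the coefficient of
  the basis element \<open>(g, w)\<close>.
\<close>

type_synonym ('g, 'k) thvec = "'g list \<Rightarrow> 'g \<Rightarrow> 'k"

definition th_scale :: "'k::field \<Rightarrow> ('g, 'k) thvec \<Rightarrow> ('g, 'k) thvec" where
  "th_scale c f = (\<lambda>w g. c * f w g)"

text \<open>Degree \<open>p \<ge> 0\<close> carries \<open>C\<^sup>p\<close>, degree \<open>-s-1\<close> with \<open>s \<ge> 0\<close> carries \<open>C\<^sub>s\<close>.\<close>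

definition tate_len :: "int \<Rightarrow> nat" where
  "tate_len p = (if 0 \<le> p then nat p else nat (- p - 1))"

definition th_space :: "('g, 'b) monoid_scheme \<Rightarrow> int \<Rightarrow> ('g, 'k::field) thvec set" where
  "th_space G p = {f. \<forall>w g. f w g \<noteq> 0 \<longrightarrow> w \<in> bar_words G (tate_len p) \<and> g \<in> carrier G}"

definition cochain ::
  "('g, 'b) monoid_scheme \<Rightarrow> nat \<Rightarrow> ('g list \<Rightarrow> 'g \<Rightarrow> 'k::field) \<Rightarrow> ('g, 'k) thvec" where
  "cochain G n F = (\<lambda>w g. if w \<in> bar_words G n then F w g else 0)"

text \<open>The chain \<open>(a, w)\<close> with \<open>a \<in> kG\<close>, which is \<open>0\<close> if \<open>w\<close> has an entry \<open>1\<close>.\<close>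

definition gchain ::
  "('g, 'b) monoid_scheme \<Rightarrow> ('g \<Rightarrow> 'k::field) \<Rightarrow> 'g list \<Rightarrow> ('g, 'k) thvec" where
  "gchain G a w = (\<lambda>v g. if v = w \<and> \<one>\<^bsub>G\<^esub> \<notin> set w then a g else 0)"

text \<open>Linear extension to \<open>C\<^sub>s\<close> of a map \<open>F\<close> given on the basis elements \<open>(g\<^sub>0, w)\<close>.\<close>

definition chain_extend ::
  "('g, 'b) monoid_scheme \<Rightarrow> nat \<Rightarrow> ('g \<Rightarrow> 'g list \<Rightarrow> ('g, 'k::field) thvec) \<Rightarrow> ('g, 'k) thvec
    \<Rightarrow> ('g, 'k) thvec" where
  "chain_extend G s F c =
     (\<Sum>w\<in>bar_words G s. \<Sum>g\<^sub>0\<in>carrier G. th_scale (c w g\<^sub>0) (F g\<^sub>0 w))"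

definition hoch_codiff ::
  "('g, 'b) monoid_scheme \<Rightarrow> nat \<Rightarrow> ('g, 'k::field) thvec \<Rightarrow> ('g, 'k) thvec" where
  "hoch_codiff G n f = cochain G (n + 1) (\<lambda>w x.
     gmult G (gsingle (w ! 0)) (f (seg w 2 (n + 1))) x +
     (\<Sum>i=1..n. (-1) ^ i * f (merge_at G w i) x) +
     (-1) ^ (n + 1) * gmult G (f (seg w 1 n)) (gsingle (w ! n)) x)"

definition hoch_diff ::
  "('g, 'b) monoid_scheme \<Rightarrow> nat \<Rightarrow> ('g, 'k::field) thvec \<Rightarrow> ('g, 'k) thvec" where
  "hoch_diff G n = chain_extend G n (\<lambda>g\<^sub>0 w.
     gchain G (gsingle (g\<^sub>0 \<otimes>\<^bsub>G\<^esub> w ! 0)) (seg w 2 n) +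
     (\<Sum>i=1..n-1. th_scale ((-1) ^ i) (gchain G (gsingle g\<^sub>0) (merge_at G w i))) +
     th_scale ((-1) ^ n) (gchain G (gsingle (w ! (n - 1) \<otimes>\<^bsub>G\<^esub> g\<^sub>0)) (seg w 1 (n - 1))))"

definition hoch_norm :: "('g, 'b) monoid_scheme \<Rightarrow> ('g, 'k::field) thvec \<Rightarrow> ('g, 'k) thvec" where
  "hoch_norm G = chain_extend G 0 (\<lambda>h w.
     cochain G 0 (\<lambda>_. \<Sum>g\<in>carrier G. gsingle (g \<otimes>\<^bsub>G\<^esub> h \<otimes>\<^bsub>G\<^esub> inv\<^bsub>G\<^esub> g)))"

definition th_diff ::
  "('g, 'b) monoid_scheme \<Rightarrow> int \<Rightarrow> ('g, 'k::field) thvec \<Rightarrow> ('g, 'k) thvec" where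
  "th_diff G p f =
     (if 0 \<le> p then hoch_codiff G (tate_len p) f
      else if p = -1 then hoch_norm G f
      else th_scale ((-1) ^ tate_len p) (hoch_diff G (tate_len p) f))"

definition th_pair ::
  "('g, 'b) monoid_scheme \<Rightarrow> int \<times> ('g, 'k::field) thvec \<Rightarrow> int \<times> ('g, 'k) thvec \<Rightarrow> 'k" where
  "th_pair G x y = (case (x, y) of ((p, a), (q, b)) \<Rightarrow>
     if 0 \<le> p \<and> q < 0 \<and> tate_len p = tate_len q then
       (\<Sum>w\<in>bar_words G (tate_len p). gpair G (a w) (b w))
     else if p < 0 \<and> 0 \<le> q \<and> tate_len p = tate_len q then
       (\<Sum>w\<in>bar_words G (tate_len p). gpair G (b w) (a w))
     else 0)"

definition th_cup ::
  "('g, 'b) monoid_scheme \<Rightarrow> int \<times> ('g, 'k::field) thvec \<Rightarrow> int \<times> ('g, 'k) thvec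
    \<Rightarrow> ('g, 'k) thvec" where
  "th_cup G x y = (case (x, y) of ((p, a), (q, b)) \<Rightarrow>
     if 0 \<le> p \<and> 0 \<le> q then
       (let n = tate_len p; m = tate_len q in
        cochain G (n + m) (\<lambda>w. gmult G (a (seg w 1 n)) (b (seg w (n + 1) (n + m)))))
     else if p < 0 \<and> q < 0 then
       (let s = tate_len p; t = tate_len q in
        chain_extend G s (\<lambda>g\<^sub>0 gs. chain_extend G t (\<lambda>h\<^sub>0 hs.
          \<Sum>g\<in>carrier G.
            gchain G (gsingle (g \<otimes>\<^bsub>G\<^esub> h\<^sub>0)) (hs @ [inv\<^bsub>G\<^esub> g \<otimes>\<^bsub>G\<^esub> g\<^sub>0] @ gs)) b) a)
     else if 0 \<le> p then
       (let n = tate_len p; t = tate_len q in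
        if n \<le> t then
          chain_extend G t (\<lambda>h\<^sub>0 hs.
            gchain G (gmult G (a (seg hs (t - n + 1) t)) (gsingle h\<^sub>0)) (seg hs 1 (t - n))) b
        else
          chain_extend G t (\<lambda>g\<^sub>0 gs. cochain G (n - t - 1) (\<lambda>hs.
            \<Sum>g\<in>carrier G. gmult G (a (hs @ [inv\<^bsub>G\<^esub> g] @ gs)) (gsingle (g\<^sub>0 \<otimes>\<^bsub>G\<^esub> g)))) b)
     else
       (let s = tate_len p; m = tate_len q in
        if m \<le> s then
          chain_extend G s (\<lambda>g\<^sub>0 gs.
            gchain G (gmult G (gsingle g\<^sub>0) (b (seg gs 1 m))) (seg gs (m + 1) s)) a
        else
          chain_extend G s (\<lambda>g\<^sub>0 gs. cochain G (m - s - 1) (\<lambda>hs.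
            \<Sum>g\<in>carrier G. gmult G (gsingle (g \<otimes>\<^bsub>G\<^esub> g\<^sub>0)) (b (gs @ [inv\<^bsub>G\<^esub> g] @ hs)))) a))"

text \<open>
  Index conditions and bounds such as \<open>m-r+j-2 \<ge> 0\<close> are written as \<open>r+2 \<le> m+j\<close> and \<open>m+j-r-2\<close>, so
  that subtraction on the naturals never truncates.
\<close>

definition th_m3 ::
  "('g, 'b) monoid_scheme \<Rightarrow> int \<times> ('g, 'k::field) thvec \<Rightarrow> int \<times> ('g, 'k) thvec
    \<Rightarrow> int \<times> ('g, 'k) thvec \<Rightarrow> ('g, 'k) thvec" where
  "th_m3 G x y z = (case (x, y, z) of ((p, a), (q, b), (l, c)) \<Rightarrow>
     if 0 \<le> p \<and> q < 0 \<and> 0 \<le> l then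
       (let m = tate_len p; r = tate_len q; n = tate_len l in
        if r + 2 \<le> m + n then
          chain_extend G r (\<lambda>g\<^sub>0 gs. cochain G (m + n - r - 2) (\<lambda>hs u.
            \<Sum>g\<in>carrier G. \<Sum>j\<in>{j. 1 \<le> j \<and> j \<le> min n (r + 1) \<and> r + 2 \<le> m + j}.
              (-1) ^ (m + r + j - 1) *
              gmult G
                (gmult G (a (seg hs 1 (m + j - r - 2) @ [g] @ seg gs j r)) (gsingle g\<^sub>0))
                (c (seg gs 1 (j - 1) @ [inv\<^bsub>G\<^esub> g] @ seg hs (m + j - r - 1) (m + n - r - 2))) u)) b
        else 0)
     else if p < 0 \<and> 0 \<le> q \<and> l < 0 then
       (let r = tate_len p; m = tate_len q; s = tate_len l in
        if m \<le> r + s + 1 then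
          chain_extend G r (\<lambda>g\<^sub>0 gs. chain_extend G s (\<lambda>h\<^sub>0 hs.
            \<Sum>g\<in>carrier G. \<Sum>j\<in>{j. j \<le> s \<and> s + 1 \<le> m + j \<and> m + j \<le> r + s + 1}.
              th_scale ((-1) ^ (r + s + m - j))
                (gchain G
                  (gmult G
                    (gmult G (gsingle g\<^sub>0) (b (seg gs 1 (m + j - s - 1) @ [g] @ seg hs (j + 1) s)))
                    (gsingle h\<^sub>0))
                  (seg hs 1 j @ [inv\<^bsub>G\<^esub> g] @ seg gs (m + j - s) r))) c) a
        else 0)
     else 0)"

definition th_op ::
  "('g, 'b) monoid_scheme \<Rightarrow> nat \<Rightarrow> (int \<times> ('g, 'k::field) thvec) list \<Rightarrow> ('g, 'k) thvec" where
  "th_op G i xs =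
     (if i = 1 then th_diff G (fst (xs ! 0)) (snd (xs ! 0))
      else if i = 2 then th_cup G (xs ! 0) (xs ! 1)
      else if i = 3 then th_m3 G (xs ! 0) (xs ! 1) (xs ! 2)
      else 0)"

definition th_component ::
  "('g, 'b) monoid_scheme \<Rightarrow> 'g \<Rightarrow> int \<Rightarrow> ('g, 'k::field) thvec set" where
  "th_component G x p =
     (if 0 \<le> p then
        {f \<in> th_space G p. \<forall>w\<in>bar_words G (tate_len p). \<forall>g.
           f w g \<noteq> 0 \<longrightarrow> g \<in> {word_prod G w \<otimes>\<^bsub>G\<^esub> u | u. u \<in> conj_class G x}}
      else
        {f \<in> th_space G p. \<forall>w\<in>bar_words G (tate_len p). \<forall>g.
           f w g \<noteq> 0 \<longrightarrow> g \<in> {inv_word_prod G w \<otimes>\<^bsub>G\<^esub> u | u. u \<in> conj_class G x}})"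


lemma th_component_iff:
  assumes "group G" "x \<in> carrier G"
  shows "f \<in> th_component G x p \<longleftrightarrow> f \<in> th_space G p \<and>
    (\<forall>w g. f w g \<noteq> 0 \<longrightarrow>
      inv\<^bsub>G\<^esub> (if 0 \<le> p then word_prod G w else inv_word_prod G w) \<otimes>\<^bsub>G\<^esub> g \<in> conj_class G x)"
proof -
  interpret group G by fact
  have wp: "word_prod G w \<in> carrier G" if "set w \<subseteq> carrier G" for w
    using that by (induction w) (auto simp: word_prod_def)
  have iwp: "inv_word_prod G w \<in> carrier G" if "set w \<subseteq> carrier G" for w
    using that unfolding inv_word_prod_def by (intro wp) auto
  have cc: "u \<in> carrier G" if "u \<in> conj_class G x" for u
    using that assms(2) by (auto simp: conj_class_def)
  have eq: "g \<in> {a \<otimes>\<^bsub>G\<^esub> u | u. u \<in> conj_class G x} \<longleftrightarrow> inv\<^bsub>G\<^esub> a \<otimes>\<^bsub>G\<^esub> g \<in> conj_class G x"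
    if "a \<in> carrier G" "g \<in> carrier G" for a g
  proof
    assume "g \<in> {a \<otimes>\<^bsub>G\<^esub> u | u. u \<in> conj_class G x}"
    then show "inv\<^bsub>G\<^esub> a \<otimes>\<^bsub>G\<^esub> g \<in> conj_class G x"
      using that cc by (auto simp: m_assoc [symmetric])
  next
    assume "inv\<^bsub>G\<^esub> a \<otimes>\<^bsub>G\<^esub> g \<in> conj_class G x"
    moreover have "g = a \<otimes>\<^bsub>G\<^esub> (inv\<^bsub>G\<^esub> a \<otimes>\<^bsub>G\<^esub> g)"
      using that by (simp add: m_assoc [symmetric])
    ultimately show "g \<in> {a \<otimes>\<^bsub>G\<^esub> u | u. u \<in> conj_class G x}" by blast
  qed
  show ?thesis
  proof (cases "f \<in> th_space G p")
    case True
    then have *: "w \<in> bar_words G (tate_len p)" "set w \<subseteq> carrier G" "g \<in> carrier G"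
      if "f w g \<noteq> 0" for w g
      using that by (auto simp: th_space_def bar_words_def)
    let ?u = "\<lambda>w. if 0 \<le> p then word_prod G w else inv_word_prod G w"
    have u: "?u w \<in> carrier G" if "f w g \<noteq> 0" for w g
      using *(2)[OF that] wp iwp by simp
    have iff: "g \<in> {?u w \<otimes>\<^bsub>G\<^esub> v | v. v \<in> conj_class G x} \<longleftrightarrow> inv\<^bsub>G\<^esub> ?u w \<otimes>\<^bsub>G\<^esub> g \<in> conj_class G x"
      if "f w g \<noteq> 0" for w g
      by (rule eq[OF u[OF that] *(3)[OF that]])
    have "f \<in> th_component G x p \<longleftrightarrow>
        (\<forall>w g. f w g \<noteq> 0 \<longrightarrow> g \<in> {?u w \<otimes>\<^bsub>G\<^esub> v | v. v \<in> conj_class G x})"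
    proof (cases "0 \<le> p")
      case p: True
      show ?thesis
        unfolding th_component_def if_P[OF p] mem_Collect_eq using True *(1) by blast
    next
      case p: False
      show ?thesis
        unfolding th_component_def if_not_P[OF p] mem_Collect_eq using True *(1) by blast
    qed
    also have "\<dots> \<longleftrightarrow> (\<forall>w g. f w g \<noteq> 0 \<longrightarrow> inv\<^bsub>G\<^esub> ?u w \<otimes>\<^bsub>G\<^esub> g \<in> conj_class G x)"
      using iff by (intro all_cong1 imp_cong) auto
    finally show ?thesis using True by (simp only: simp_thms)
  next
    case False
    then show ?thesis by (auto simp: th_component_def)
  qed
qed

text \<open>The decomposition of \<open>th_space\<close>, degree by degree, as the direct sum of its components.\<close>

lemma th_decomposition:
  fixes f :: "('g, 'k::field) thvec"
  assumes "group G" "finite (carrier G)" "conj_reps G X" "f \<in> th_space G p"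
  shows "\<exists>!h. (\<forall>x\<in>X. h x \<in> th_component G x p) \<and> (\<forall>x. x \<notin> X \<longrightarrow> h x = 0) \<and> (\<Sum>x\<in>X. h x) = f"
proof -
  interpret group G by fact
  define u where "u = (\<lambda>w. if 0 \<le> p then word_prod G w else inv_word_prod G w)"
  have X: "X \<subseteq> carrier G" and finX: "finite X"
    using assms(2,3) by (auto simp: conj_reps_def intro: finite_subset)
  have wp: "word_prod G w \<in> carrier G" if "set w \<subseteq> carrier G" for w
    using that by (induction w) (auto simp: word_prod_def)
  have iwp: "inv_word_prod G w \<in> carrier G" if "set w \<subseteq> carrier G" for w
    using that unfolding inv_word_prod_def by (intro wp) auto
  have u: "u w \<in> carrier G" if "w \<in> bar_words G n" for w n
  proof -
    have "set w \<subseteq> carrier G" using that by (auto simp: bar_words_def)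
    then show ?thesis using wp iwp by (simp add: u_def)
  qed
  have ex1: "\<exists>!x. x \<in> X \<and> inv\<^bsub>G\<^esub> (u w) \<otimes>\<^bsub>G\<^esub> g \<in> conj_class G x"
    if "w \<in> bar_words G n" "g \<in> carrier G" for w g n
    using assms(3) u[OF that(1)] that(2) by (auto simp: conj_reps_def)
  have comp: "h \<in> th_component G x p \<longleftrightarrow> h \<in> th_space G p \<and>
      (\<forall>w g. h w g \<noteq> 0 \<longrightarrow> inv\<^bsub>G\<^esub> (u w) \<otimes>\<^bsub>G\<^esub> g \<in> conj_class G x)"
    if "x \<in> X" for h :: "('g, 'k) thvec" and x
    using th_component_iff[OF assms(1), of x h p] that X unfolding u_def by blast
  have sum_app: "(\<Sum>x\<in>X. h x) w g = (\<Sum>x\<in>X. h x w g)" for h :: "'g \<Rightarrow> ('g, 'k) thvec" and w g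
    using finX by (induction X rule: finite_induct) auto
  show ?thesis
  proof (rule ex1I[of _ "\<lambda>x w g. if x \<in> X \<and> inv\<^bsub>G\<^esub> (u w) \<otimes>\<^bsub>G\<^esub> g \<in> conj_class G x then f w g else 0"],
      intro conjI ballI allI impI)
    fix x assume "x \<in> X"
    then show "(\<lambda>w g. if x \<in> X \<and> inv\<^bsub>G\<^esub> (u w) \<otimes>\<^bsub>G\<^esub> g \<in> conj_class G x then f w g else 0)
        \<in> th_component G x p"
      using assms(4) by (auto simp: comp th_space_def)
  next
    fix x assume "x \<notin> X"
    then show "(\<lambda>w g. if x \<in> X \<and> inv\<^bsub>G\<^esub> (u w) \<otimes>\<^bsub>G\<^esub> g \<in> conj_class G x then f w g else 0) = 0"
      by (auto simp: fun_eq_iff)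
  next
    show "(\<Sum>x\<in>X. (\<lambda>w g. if x \<in> X \<and> inv\<^bsub>G\<^esub> (u w) \<otimes>\<^bsub>G\<^esub> g \<in> conj_class G x then f w g else 0)) = f"
    proof (intro ext)
      fix w g
      have "(\<Sum>x\<in>X. if x \<in> X \<and> inv\<^bsub>G\<^esub> (u w) \<otimes>\<^bsub>G\<^esub> g \<in> conj_class G x then f w g else 0) = f w g"
      proof (cases "f w g = 0")
        case False
        then have wg: "w \<in> bar_words G (tate_len p)" "g \<in> carrier G"
          using assms(4) by (auto simp: th_space_def)
        obtain y where y: "y \<in> X" "inv\<^bsub>G\<^esub> (u w) \<otimes>\<^bsub>G\<^esub> g \<in> conj_class G y"
          "\<And>z. z \<in> X \<Longrightarrow> inv\<^bsub>G\<^esub> (u w) \<otimes>\<^bsub>G\<^esub> g \<in> conj_class G z \<Longrightarrow> z = y"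
          using ex1[OF wg] by blast
        have "(\<Sum>x\<in>X. if x \<in> X \<and> inv\<^bsub>G\<^esub> (u w) \<otimes>\<^bsub>G\<^esub> g \<in> conj_class G x then f w g else 0)
            = (\<Sum>x\<in>X. if x = y then f w g else 0)"
        proof (intro sum.cong refl)
          fix x assume x: "x \<in> X"
          show "(if x \<in> X \<and> inv\<^bsub>G\<^esub> (u w) \<otimes>\<^bsub>G\<^esub> g \<in> conj_class G x then f w g else 0)
            = (if x = y then f w g else 0)"
          proof (cases "x = y")
            case True
            then show ?thesis using y(1,2) by simp
          next
            case False
            then have "inv\<^bsub>G\<^esub> (u w) \<otimes>\<^bsub>G\<^esub> g \<notin> conj_class G x" using y(3)[OF x] by blast
            then show ?thesis using False by simp
          qed
        qed
        then show ?thesis using y(1) finX by simp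
      qed (auto intro: sum.neutral)
      then show "(\<Sum>x\<in>X. (\<lambda>w g. if x \<in> X \<and> inv\<^bsub>G\<^esub> (u w) \<otimes>\<^bsub>G\<^esub> g \<in> conj_class G x then f w g else 0)) w g
          = f w g"
        by (simp add: sum_app)
    qed
  next
    fix h :: "'g \<Rightarrow> ('g, 'k) thvec"
    assume h: "(\<forall>x\<in>X. h x \<in> th_component G x p) \<and> (\<forall>x. x \<notin> X \<longrightarrow> h x = 0) \<and> (\<Sum>x\<in>X. h x) = f"
    show "h = (\<lambda>x w g. if x \<in> X \<and> inv\<^bsub>G\<^esub> (u w) \<otimes>\<^bsub>G\<^esub> g \<in> conj_class G x then f w g else 0)"
    proof (intro ext)
      fix x w g
      show "h x w g = (if x \<in> X \<and> inv\<^bsub>G\<^esub> (u w) \<otimes>\<^bsub>G\<^esub> g \<in> conj_class G x then f w g else 0)"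
      proof (cases "x \<in> X \<and> inv\<^bsub>G\<^esub> (u w) \<otimes>\<^bsub>G\<^esub> g \<in> conj_class G x")
        case False
        have "h x w g = 0"
        proof (cases "x \<in> X")
          case x: True
          then show ?thesis using h comp[OF x, of "h x"] False by blast
        qed (use h in simp)
        then show ?thesis unfolding if_not_P[OF False] .
      next
        case True
        have "h y w g = 0" if y: "y \<in> X - {x}" for y
        proof (rule ccontr)
          assume nz: "h y w g \<noteq> 0"
          then have "inv\<^bsub>G\<^esub> (u w) \<otimes>\<^bsub>G\<^esub> g \<in> conj_class G y" "h y \<in> th_space G p"
            using h comp y by auto
          moreover from this nz have wg: "w \<in> bar_words G (tate_len p)" "g \<in> carrier G"
            by (auto simp: th_space_def)
          ultimately show False using ex1[OF wg] True y by blast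
        qed
        then have "(\<Sum>y\<in>X. h y w g) = h x w g"
          using True finX by (simp add: sum.remove[of X x])
        then show ?thesis using h True sum_app[of h w g] by simp
      qed
    qed
  qed
qed


section \<open>The Tate cochain complex with trivial coefficients\<close>

text \<open>
  The same encoding as above: \<open>f w\<close> is the value at \<open>w\<close> of a cochain, or the coefficient of the
  basis element \<open>w\<close> in a chain.
\<close>

definition tate_scale :: "'k::field \<Rightarrow> ('g list \<Rightarrow> 'k) \<Rightarrow> 'g list \<Rightarrow> 'k" where
  "tate_scale c f = (\<lambda>w. c * f w)"

definition tate_space :: "('g, 'b) monoid_scheme \<Rightarrow> int \<Rightarrow> ('g list \<Rightarrow> 'k::field) set" where
  "tate_space G p = {f. \<forall>w. f w \<noteq> 0 \<longrightarrow> w \<in> bar_words G (tate_len p)}"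

definition word_chain :: "('g, 'b) monoid_scheme \<Rightarrow> 'g list \<Rightarrow> 'g list \<Rightarrow> 'k::field" where
  "word_chain G w = (\<lambda>v. if v = w \<and> \<one>\<^bsub>G\<^esub> \<notin> set w then 1 else 0)"

definition group_codiff ::
  "('g, 'b) monoid_scheme \<Rightarrow> nat \<Rightarrow> ('g list \<Rightarrow> 'k::field) \<Rightarrow> 'g list \<Rightarrow> 'k" where
  "group_codiff G n f = (\<lambda>w. if w \<in> bar_words G (n + 1) then
     f (seg w 2 (n + 1)) + (\<Sum>i=1..n. (-1) ^ i * f (merge_at G w i)) + (-1) ^ (n + 1) * f (seg w 1 n)
     else 0)"

definition group_diff ::
  "('g, 'b) monoid_scheme \<Rightarrow> nat \<Rightarrow> ('g list \<Rightarrow> 'k::field) \<Rightarrow> 'g list \<Rightarrow> 'k" where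
  "group_diff G n f = (\<Sum>w\<in>bar_words G n. tate_scale (f w)
     (word_chain G (seg w 2 n) +
      (\<Sum>i=1..n-1. tate_scale ((-1) ^ i) (word_chain G (merge_at G w i))) +
      tate_scale ((-1) ^ n) (word_chain G (seg w 1 (n - 1)))))"

definition tate_diff ::
  "('g, 'b) monoid_scheme \<Rightarrow> int \<Rightarrow> ('g list \<Rightarrow> 'k::field) \<Rightarrow> 'g list \<Rightarrow> 'k" where
  "tate_diff G p f =
     (if 0 \<le> p then group_codiff G (tate_len p) f
      else if p = -1 then tate_scale (of_nat (order G)) f
      else tate_scale ((-1) ^ tate_len p) (group_diff G (tate_len p) f))"

definition tate_iota ::
  "('g, 'b) monoid_scheme \<Rightarrow> int \<Rightarrow> ('g list \<Rightarrow> 'k::field) \<Rightarrow> ('g, 'k) thvec" where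
  "tate_iota G p f =
     (if 0 \<le> p then
        cochain G (tate_len p) (\<lambda>w g. f w * gsingle (word_prod G w) g)
      else
        (\<Sum>w\<in>bar_words G (tate_len p). th_scale (f w) (gchain G (gsingle (inv_word_prod G w)) w)))"

definition tate_image ::
  "('g, 'b) monoid_scheme \<Rightarrow> int \<Rightarrow> ('g, 'k::field) thvec set" where
  "tate_image G p = tate_iota G p ` tate_space G p"

end

theory Submission
  imports Defs
begin

text \<open>
  Attach to a basis element a group element, its holonomy: \<open>(\<Prod>w)\<inverse> g\<close> for the cochain that sends the
  word \<open>w\<close> to \<open>g\<close>, and \<open>(\<Prod>w) g\<close> for the chain \<open>(g, w)\<close>.  The component of \<open>x\<close> is spanned by the basis
  elements whose holonomy is conjugate to \<open>x\<close>.  In particular \<open>g\<close> is determined by \<open>w\<close> in the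
  component of \<open>1\<close>: it is \<open>\<Prod>w\<close> for cochains and \<open>(\<Prod>w)\<inverse>\<close> for chains.

  The differential merges adjacent letters, or moves a letter around the cyclic word \<open>g\<^sub>0 g\<^sub>1 \<cdots> g\<^sub>n\<close>,
  so it changes the holonomy by a conjugation at most.  In \<open>\<union>\<close> and \<open>m\<^sub>3\<close> the arguments from the
  component of \<open>1\<close> contribute products of letters that cancel against the rest of the word, and the
  summation letter \<open>g\<close> meets its inverse or conjugates.  Hence with all arguments but the last
  in the component of \<open>1\<close>, the result has the holonomy of the last argument up to conjugacy; these are
  the lemmas \<open>th_diff_component\<close>, \<open>th_cup_component\<close> and \<open>th_m3_component\<close>.

  The Stasheff identities, for the subalgebra and for the modules, and the cyclic symmetry are
  identities in the ambient algebra, so closure under the operations is all that is required for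
  them.  The pairing of the images of \<open>f\<close> and \<open>h\<close> under \<open>\<iota>\<close> is \<open>\<Sum>\<^sub>w f(w) h(w)\<close>, since the holonomies
  match up the group coefficients; this gives nondegeneracy on the component of \<open>1\<close>.

  Finally, the augmentation \<open>kG \<rightarrow> k\<close>, applied to the coefficients, is a chain map from the
  Tate-Hochschild complex to the Tate complex, because it is multiplicative.  On the component of
  \<open>1\<close> it is inverse to \<open>\<iota>\<close>.  As this component is a subcomplex, \<open>\<iota>\<close> is a chain map too.
\<close>

section \<open>Supports of the building blocks\<close>

lemma sum_vec_apply: "(\<Sum>i\<in>A. F i) w = (\<Sum>i\<in>A. F i w)"
  for F :: "'i \<Rightarrow> 'a \<Rightarrow> 'c::comm_monoid_add"
  by (induction A rule: infinite_finite_induct) auto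

lemma sum_nonzeroE:
  assumes "(\<Sum>i\<in>A. f i) \<noteq> 0"
  obtains i where "i \<in> A" "f i \<noteq> 0"
  using assms by (rule sum.not_neutral_contains_not_neutral)

lemma gsingle_nonzero [simp]: "(gsingle h g :: 'k::field) \<noteq> 0 \<longleftrightarrow> g = h"
  by (simp add: gsingle_def)

lemma gmult_nonzeroE:
  assumes "gmult G a b g \<noteq> (0 :: 'k::field)"
  obtains h h' where "h \<in> carrier G" "h' \<in> carrier G" "g = h \<otimes>\<^bsub>G\<^esub> h'" "a h \<noteq> 0" "b h' \<noteq> 0"
proof -
  from assms obtain h where h: "h \<in> carrier G"
    "(\<Sum>h'\<in>carrier G. if h \<otimes>\<^bsub>G\<^esub> h' = g then a h * b h' else 0) \<noteq> 0"
    unfolding gmult_def by (rule sum_nonzeroE)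
  from h(2) obtain h' where "h' \<in> carrier G" "(if h \<otimes>\<^bsub>G\<^esub> h' = g then a h * b h' else 0) \<noteq> 0"
    by (rule sum_nonzeroE)
  with h(1) that show thesis by (auto split: if_splits)
qed

lemma gchain_nonzero: "gchain G a w v g \<noteq> (0 :: 'k::field) \<longleftrightarrow> v = w \<and> \<one>\<^bsub>G\<^esub> \<notin> set w \<and> a g \<noteq> 0"
  by (simp add: gchain_def)

lemma cochain_nonzero: "cochain G n F w g \<noteq> (0 :: 'k::field) \<longleftrightarrow> w \<in> bar_words G n \<and> F w g \<noteq> 0"
  by (simp add: cochain_def)

lemma chain_extend_apply:
  "chain_extend G s F c v g =
     (\<Sum>w\<in>bar_words G s. \<Sum>g\<^sub>0\<in>carrier G. c w g\<^sub>0 * F g\<^sub>0 w v g)"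
  by (simp add: chain_extend_def sum_vec_apply th_scale_def)

lemma chain_extend_nonzeroE:
  assumes "chain_extend G s F c v g \<noteq> 0"
  obtains w g\<^sub>0 where "w \<in> bar_words G s" "g\<^sub>0 \<in> carrier G" "c w g\<^sub>0 \<noteq> 0" "F g\<^sub>0 w v g \<noteq> 0"
proof -
  from assms obtain w where w: "w \<in> bar_words G s" "(\<Sum>g\<^sub>0\<in>carrier G. c w g\<^sub>0 * F g\<^sub>0 w v g) \<noteq> 0"
    unfolding chain_extend_apply by (rule sum_nonzeroE)
  from w(2) obtain g\<^sub>0 where "g\<^sub>0 \<in> carrier G" "c w g\<^sub>0 * F g\<^sub>0 w v g \<noteq> 0" by (rule sum_nonzeroE)
  with w(1) that show thesis by auto
qed

lemma bar_words_carrier: "w \<in> bar_words G n \<Longrightarrow> set w \<subseteq> carrier G"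
  by (auto simp: bar_words_def)

lemma finite_bar_words: "finite (carrier G) \<Longrightarrow> finite (bar_words G n)"
  by (rule finite_subset[OF _ finite_lists_length_eq[of "carrier G" n]]) (auto simp: bar_words_def)

lemma tate_len_dual [simp]: "tate_len (- p - 1) = tate_len p"
  by (simp add: tate_len_def)


section \<open>Products of segments of words\<close>

lemma set_seg: "set (seg w i j) \<subseteq> set w"
  unfolding seg_def by (meson order_trans set_drop_subset set_take_subset)

lemma seg_append:
  assumes "1 \<le> i" "i \<le> j + 1" "j \<le> k"
  shows "seg w i j @ seg w (j + 1) k = seg w i k"
proof -
  have "k + 1 - i = (j + 1 - i) + (k - j)" "j = (j + 1 - i) + (i - 1)" using assms by auto
  then have "seg w i k = take (j + 1 - i) (drop (i - 1) w)
      @ take (k - j) (drop (j + 1 - i) (drop (i - 1) w))"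
    unfolding seg_def by (metis take_add)
  also have "drop (j + 1 - i) (drop (i - 1) w) = drop j w" using assms by simp
  finally show ?thesis by (simp add: seg_def)
qed

lemma seg_whole: "length w = n \<Longrightarrow> seg w 1 n = w"
  by (simp add: seg_def)

lemma seg_split:
  assumes "length w = n" "j \<le> n"
  shows "seg w 1 j @ seg w (j + 1) n = w"
  using seg_append[of 1 j n w] seg_whole[of w n] assms by simp

context group
begin

text \<open>
  Together with associativity and the rules for inverses, these cancellations bring every word in a
  group to its reduced form, so that the simplifier decides the group identities below.
\<close>

lemma inv_cancel_left [simp]:
  assumes "x \<in> carrier G" "y \<in> carrier G"
  shows "inv x \<otimes> (x \<otimes> y) = y" "x \<otimes> (inv x \<otimes> y) = y"
  using assms by (simp_all add: m_assoc [symmetric])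

lemma word_prod_Nil [simp]: "word_prod G [] = \<one>"
  and word_prod_Cons [simp]: "word_prod G (g # w) = g \<otimes> word_prod G w"
  by (simp_all add: word_prod_def)

lemma word_prod_closed [simp]: "set w \<subseteq> carrier G \<Longrightarrow> word_prod G w \<in> carrier G"
  by (induction w) auto

lemma word_prod_append [simp]:
  "set v \<subseteq> carrier G \<Longrightarrow> set w \<subseteq> carrier G \<Longrightarrow>
    word_prod G (v @ w) = word_prod G v \<otimes> word_prod G w"
  by (induction v) (auto simp: m_assoc)

lemma inv_word_prod_eq: "set w \<subseteq> carrier G \<Longrightarrow> inv_word_prod G w = inv (word_prod G w)"
proof (induction w)
  case (Cons g w)
  then have "set (rev (map (\<lambda>a. inv a) w)) \<subseteq> carrier G" by auto
  with Cons show ?case by (simp add: inv_word_prod_def inv_mult_group del: set_rev set_map)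
qed (simp add: inv_word_prod_def)

lemma word_prod_seg_closed [simp]: "set w \<subseteq> carrier G \<Longrightarrow> word_prod G (seg w i j) \<in> carrier G"
  using set_seg[of w i j] by auto

lemma seg_carrier: "set w \<subseteq> carrier G \<Longrightarrow> set (seg w i j) \<subseteq> carrier G"
  using set_seg[of w i j] by auto

lemma word_prod_split:
  assumes "set w \<subseteq> carrier G" "length w = n" "j \<le> n" "k = j + 1"
  shows "word_prod G w = word_prod G (seg w 1 j) \<otimes> word_prod G (seg w k n)"
  using word_prod_append[OF seg_carrier seg_carrier, of w w 1 j k n] seg_split[of w n j] assms
  by metis

lemma word_prod_merge_at:
  assumes "set w \<subseteq> carrier G" "1 \<le> i" "i < length w"
  shows "word_prod G (merge_at G w i) = word_prod G w"
proof -
  have "w = take (i - 1) w @ w ! (i - 1) # w ! i # drop (i + 1) w"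
    using assms id_take_nth_drop[of "i - 1" w] Cons_nth_drop_Suc[of i w] by simp
  moreover have "set (take (i - 1) w) \<subseteq> carrier G" "set (drop (i + 1) w) \<subseteq> carrier G"
    using assms(1) by (meson order_trans set_drop_subset set_take_subset)+
  moreover have "w ! (i - 1) \<in> carrier G" "w ! i \<in> carrier G"
    using assms by (auto simp: subset_iff)
  moreover have "merge_at G w i = take (i - 1) w @ (w ! (i - 1) \<otimes> w ! i) # drop (i + 1) w"
    using assms by (simp add: merge_at_def seg_def)
  ultimately show ?thesis
    using word_prod_append[of "take (i - 1) w" "w ! (i - 1) # w ! i # drop (i + 1) w"]
    by (simp add: m_assoc)
qed


section \<open>Conjugacy classes and components\<close>

lemma conj_class_closed: "x \<in> carrier G \<Longrightarrow> v \<in> conj_class G x \<Longrightarrow> v \<in> carrier G"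
  by (auto simp: conj_class_def)

lemma conj_class_conj:
  assumes "x \<in> carrier G" "v \<in> conj_class G x" "h \<in> carrier G"
  shows "h \<otimes> (v \<otimes> inv h) \<in> conj_class G x"
proof -
  from assms(2) obtain g where g: "g \<in> carrier G" "v = g \<otimes> x \<otimes> inv g" by (auto simp: conj_class_def)
  then have "h \<otimes> (v \<otimes> inv h) = (h \<otimes> g) \<otimes> x \<otimes> inv (h \<otimes> g)"
    using assms by (simp add: m_assoc inv_mult_group)
  then show ?thesis using g assms(3) by (auto simp: conj_class_def)
qed

lemma conj_class_conj_inv:
  assumes "x \<in> carrier G" "v \<in> conj_class G x" "h \<in> carrier G"
  shows "inv h \<otimes> (v \<otimes> h) \<in> conj_class G x"
  using conj_class_conj[OF assms(1,2), of "inv h"] assms(3) by simp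

lemma conj_class_one: "conj_class G \<one> = {\<one>}"
  by (auto simp: conj_class_def intro: exI[of _ \<one>])

text \<open>
  The next four lemmas express membership in a component by factoring out the holonomy.  For chains
  the expression \<open>g\<^sub>s\<inverse> \<cdots> g\<^sub>1\<inverse>\<close> is replaced by the inverse of the product of the word.
\<close>

lemma component_cochainI:
  assumes "x \<in> carrier G" "f \<in> th_space G p" "0 \<le> p"
    and "\<And>w g. f w g \<noteq> 0 \<Longrightarrow> set w \<subseteq> carrier G \<Longrightarrow> length w = tate_len p \<Longrightarrow>
           \<exists>v\<in>conj_class G x. g = word_prod G w \<otimes> v"
  shows "f \<in> th_component G x p"
  using assms(2-4) by (fastforce simp: th_component_def bar_words_def)

lemma component_chainI:
  assumes "x \<in> carrier G" "f \<in> th_space G p" "p < 0"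
    and "\<And>w g. f w g \<noteq> 0 \<Longrightarrow> set w \<subseteq> carrier G \<Longrightarrow> length w = tate_len p \<Longrightarrow>
           \<exists>v\<in>conj_class G x. g = inv (word_prod G w) \<otimes> v"
  shows "f \<in> th_component G x p"
proof -
  have "\<exists>v. g = inv_word_prod G w \<otimes> v \<and> v \<in> conj_class G x"
    if "w \<in> bar_words G (tate_len p)" "f w g \<noteq> 0" for w g
    using assms(4)[OF that(2) bar_words_carrier[OF that(1)]] that(1) bar_words_carrier[OF that(1)]
    by (auto simp: inv_word_prod_eq bar_words_def)
  then show ?thesis using assms(2,3) by (auto simp: th_component_def)
qed

lemma component_cochainE:
  assumes "f \<in> th_component G x p" "0 \<le> p" "f w g \<noteq> 0"
  obtains v where "v \<in> conj_class G x" "g = word_prod G w \<otimes> v"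
proof -
  have "w \<in> bar_words G (tate_len p)"
    using assms by (auto simp: th_component_def th_space_def)
  then show thesis using assms that by (auto simp: th_component_def)
qed

lemma component_chainE:
  assumes "f \<in> th_component G x p" "p < 0" "f w g \<noteq> 0"
  obtains v where "v \<in> conj_class G x" "g = inv (word_prod G w) \<otimes> v"
proof -
  have "w \<in> bar_words G (tate_len p)"
    using assms by (auto simp: th_component_def th_space_def)
  then show thesis using assms that
    by (auto simp: th_component_def inv_word_prod_eq bar_words_carrier)
qed

lemma component_one_cochain:
  assumes "f \<in> th_component G \<one> p" "0 \<le> p" "f w g \<noteq> 0"
  shows "set w \<subseteq> carrier G" "g = word_prod G w"
proof -
  show w: "set w \<subseteq> carrier G"
    using assms by (auto simp: th_component_def th_space_def bar_words_def)
  show "g = word_prod G w"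
    using assms w by (auto elim!: component_cochainE simp: conj_class_one)
qed

lemma component_one_chain:
  assumes "f \<in> th_component G \<one> p" "p < 0" "f w g \<noteq> 0"
  shows "set w \<subseteq> carrier G" "g = inv (word_prod G w)"
proof -
  show w: "set w \<subseteq> carrier G"
    using assms by (auto simp: th_component_def th_space_def bar_words_def)
  show "g = inv (word_prod G w)"
    using assms w by (auto elim!: component_chainE simp: conj_class_one)
qed

lemma component_carrier:
  assumes "f \<in> th_component G x p" "f w g \<noteq> 0"
  shows "set w \<subseteq> carrier G" "length w = tate_len p" "g \<in> carrier G"
  using assms by (auto simp: th_component_def th_space_def bar_words_def split: if_splits)

lemma component_subset: "th_component G x p \<subseteq> th_space G p"
  by (auto simp: th_component_def)

lemma component_zero: "0 \<in> th_component G x p"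
  by (simp add: th_component_def th_space_def)

lemma component_lincomb:
  fixes f h :: "('a, 'k::field) thvec"
  assumes "f \<in> th_component G x p" "h \<in> th_component G x p"
  shows "f + th_scale c h \<in> th_component G x p"
proof -
  have nz: "f w g \<noteq> 0 \<or> h w g \<noteq> 0" if "(f + th_scale c h) w g \<noteq> 0" for w g
    using that by (auto simp: th_scale_def)
  show ?thesis
  proof (cases "0 \<le> p")
    case True
    then show ?thesis
      using assms nz unfolding th_component_def th_space_def if_P[OF True] mem_Collect_eq by meson
  next
    case False
    then show ?thesis
      using assms nz unfolding th_component_def th_space_def if_not_P[OF False] mem_Collect_eq by meson
  qed
qed


section \<open>The operations respect the components\<close>

text \<open>
  Merging adjacent letters does not change the product of the word.  The outer face of a cochain that
  multiplies by the last letter on the right conjugates the holonomy by this letter, and so does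
  the outer face of a chain that absorbs the first letter into \<open>g\<^sub>0\<close>.  The splicing map in degree \<open>-1\<close>
  replaces an element by its conjugates.
\<close>

lemma th_diff_component:
  fixes f :: "('a, 'k::field) thvec"
  assumes x: "x \<in> carrier G" and f: "f \<in> th_component G x p"
    and space: "th_diff G p f \<in> th_space G (p + 1)"
  shows "th_diff G p f \<in> th_component G x (p + 1)"
proof -
  note closed = conj_class_closed[OF x]
  consider "0 \<le> p" | "p = -1" | "p < -1" by linarith
  then show ?thesis
  proof cases
    case 1
    define n where "n = tate_len p"
    have n: "tate_len (p + 1) = n + 1" using 1 by (simp add: n_def tate_len_def)
    show ?thesis
    proof (rule component_cochainI[OF x space])
      show "0 \<le> p + 1" using 1 by simp
      fix w g
      assume nz: "th_diff G p f w g \<noteq> 0" and w: "set w \<subseteq> carrier G" and len: "length w = tate_len (p + 1)"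
      have len': "length w = n + 1" using len n by simp
      have w0: "w ! 0 \<in> carrier G" "w ! n \<in> carrier G" using w len' by (auto simp: subset_iff)
      have s0: "word_prod G w = w ! 0 \<otimes> word_prod G (seg w 2 (n + 1))"
      proof -
        have "seg w 1 1 = [w ! 0]" using len' by (cases w) (auto simp: seg_def)
        then show ?thesis using word_prod_split[OF w len', of 1 2] w0 by simp
      qed
      have sn: "word_prod G w = word_prod G (seg w 1 n) \<otimes> w ! n"
      proof -
        have "seg w (n + 1) (n + 1) = [w ! n]"
          using len' by (simp add: seg_def take_Suc_conv_app_nth flip: Cons_nth_drop_Suc)
        then show ?thesis using word_prod_split[OF w len', of n "n + 1"] w0 by simp
      qed
      from nz have "w \<in> bar_words G (n + 1) \<and>
          (gmult G (gsingle (w ! 0)) (f (seg w 2 (n + 1))) g +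
           (\<Sum>i=1..n. (-1) ^ i * f (merge_at G w i) g) +
           (-1) ^ (n + 1) * gmult G (f (seg w 1 n)) (gsingle (w ! n)) g) \<noteq> 0"
        using 1 by (simp add: th_diff_def hoch_codiff_def n_def cochain_def split: if_splits)
      then have "gmult G (gsingle (w ! 0)) (f (seg w 2 (n + 1))) g \<noteq> 0
        \<or> (\<Sum>i=1..n. (-1) ^ i * f (merge_at G w i) g) \<noteq> 0
        \<or> gmult G (f (seg w 1 n)) (gsingle (w ! n)) g \<noteq> 0" by auto
      then consider
          "gmult G (gsingle (w ! 0)) (f (seg w 2 (n + 1))) g \<noteq> 0"
        | "(\<Sum>i=1..n. (-1) ^ i * f (merge_at G w i) g) \<noteq> 0"
        | "gmult G (f (seg w 1 n)) (gsingle (w ! n)) g \<noteq> 0" by blast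
      then show "\<exists>v\<in>conj_class G x. g = word_prod G w \<otimes> v"
      proof cases
        case a: 1
        then obtain h where h: "g = w ! 0 \<otimes> h" "f (seg w 2 (n + 1)) h \<noteq> 0"
          by (auto elim: gmult_nonzeroE)
        obtain v where v: "v \<in> conj_class G x" "h = word_prod G (seg w 2 (n + 1)) \<otimes> v"
          using component_cochainE[OF f 1 h(2)] by blast
        then have "g = word_prod G w \<otimes> v" unfolding s0 h(1) using w w0 closed[OF v(1)] by (simp add: m_assoc)
        then show ?thesis using v by blast
      next
        case 2
        then obtain i where i: "i \<in> {1..n}" "f (merge_at G w i) g \<noteq> 0" by (auto elim: sum_nonzeroE)
        obtain v where "v \<in> conj_class G x" "g = word_prod G (merge_at G w i) \<otimes> v"
          using component_cochainE[OF f 1 i(2)] by blast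
        then show ?thesis using word_prod_merge_at[OF w, of i] i(1) len' by auto
      next
        case 3
        then obtain h where h: "g = h \<otimes> w ! n" "f (seg w 1 n) h \<noteq> 0"
          by (auto elim: gmult_nonzeroE)
        obtain v where v: "v \<in> conj_class G x" "h = word_prod G (seg w 1 n) \<otimes> v"
          using component_cochainE[OF f 1 h(2)] by blast
        then have "g = word_prod G w \<otimes> (inv (w ! n) \<otimes> (v \<otimes> w ! n))"
          unfolding sn h(1) using w w0 closed[OF v(1)] by (simp add: m_assoc)
        then show ?thesis using conj_class_conj_inv[OF x v(1) w0(2)] by blast
      qed
    qed
  next
    case 2
    show ?thesis
    proof (rule component_cochainI[OF x space])
      show "0 \<le> p + 1" using 2 by simp
      fix w g
      assume nz: "th_diff G p f w g \<noteq> 0" and len: "length w = tate_len (p + 1)"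
      have w: "w = []" using len 2 by (simp add: tate_len_def)
      from nz have "hoch_norm G f w g \<noteq> 0" using 2 by (simp add: th_diff_def)
      then obtain u h where u: "u \<in> bar_words G 0" "h \<in> carrier G" "f u h \<noteq> 0"
        "cochain G 0 (\<lambda>_. \<Sum>k\<in>carrier G. gsingle (k \<otimes> h \<otimes> inv k)) w g \<noteq> (0 :: 'k)"
        unfolding hoch_norm_def by (rule chain_extend_nonzeroE)
      have "(\<Sum>k\<in>carrier G. gsingle (k \<otimes> h \<otimes> inv k) g) \<noteq> (0 :: 'k)"
        using u(4) by (simp add: cochain_def sum_vec_apply split: if_splits)
      then obtain k where k: "k \<in> carrier G" "g = k \<otimes> h \<otimes> inv k" by (auto elim: sum_nonzeroE)
      have "u = []" using u(1) by (simp add: bar_words_def)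
      then obtain v where v: "v \<in> conj_class G x" "h = v"
        using component_chainE[OF f _ u(3)] 2 closed by auto
      then have "g = word_prod G w \<otimes> (k \<otimes> (v \<otimes> inv k))"
        using k w u(2) by (simp add: m_assoc)
      then show "\<exists>v\<in>conj_class G x. g = word_prod G w \<otimes> v"
        using conj_class_conj[OF x v(1) k(1)] by blast
    qed
  next
    case 3
    define n where "n = tate_len p"
    have n: "n \<ge> 1" "p < 0" using 3 by (auto simp: n_def tate_len_def)
    show ?thesis
    proof (rule component_chainI[OF x space])
      show "p + 1 < 0" using 3 by simp
      fix w g
      assume nz: "th_diff G p f w g \<noteq> 0"
      have "hoch_diff G n f w g \<noteq> 0" using nz 3 by (simp add: th_diff_def th_scale_def n_def)
      then obtain u g\<^sub>0 where u: "u \<in> bar_words G n" "g\<^sub>0 \<in> carrier G" "f u g\<^sub>0 \<noteq> 0"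
        and "(gchain G (gsingle (g\<^sub>0 \<otimes> u ! 0)) (seg u 2 n) +
      (\<Sum>i=1..n-1. th_scale ((-1) ^ i) (gchain G (gsingle g\<^sub>0) (merge_at G u i))) +
      th_scale ((-1) ^ n) (gchain G (gsingle (u ! (n - 1) \<otimes> g\<^sub>0)) (seg u 1 (n - 1)))) w g \<noteq> (0 :: 'k)"
        unfolding hoch_diff_def by (rule chain_extend_nonzeroE)
      then have "gchain G (gsingle (g\<^sub>0 \<otimes> u ! 0)) (seg u 2 n) w g \<noteq> (0 :: 'k)
        \<or> (\<Sum>i=1..n-1. (-1) ^ i * gchain G (gsingle g\<^sub>0) (merge_at G u i) w g) \<noteq> (0 :: 'k)
        \<or> gchain G (gsingle (u ! (n - 1) \<otimes> g\<^sub>0)) (seg u 1 (n - 1)) w g \<noteq> (0 :: 'k)"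
        by (auto simp: th_scale_def sum_vec_apply)
      then consider
          "gchain G (gsingle (g\<^sub>0 \<otimes> u ! 0)) (seg u 2 n) w g \<noteq> (0 :: 'k)"
        | "(\<Sum>i=1..n-1. (-1) ^ i * gchain G (gsingle g\<^sub>0) (merge_at G u i) w g) \<noteq> (0 :: 'k)"
        | "gchain G (gsingle (u ! (n - 1) \<otimes> g\<^sub>0)) (seg u 1 (n - 1)) w g \<noteq> (0 :: 'k)"
        by blast
      note cs = this
      have uc: "set u \<subseteq> carrier G" "length u = n" using u(1) by (auto simp: bar_words_def)
      have u0: "u ! 0 \<in> carrier G" "u ! (n - 1) \<in> carrier G" using uc n by (auto simp: subset_iff)
      have s0: "word_prod G u = u ! 0 \<otimes> word_prod G (seg u 2 n)"
      proof -
        have "seg u 1 1 = [u ! 0]" using uc n by (cases u) (auto simp: seg_def)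
        then show ?thesis using word_prod_split[OF uc, of 1 2] u0 n by simp
      qed
      have sn: "word_prod G u = word_prod G (seg u 1 (n - 1)) \<otimes> u ! (n - 1)"
      proof -
        have "seg u n n = [u ! (n - 1)]"
          using uc n by (simp add: seg_def take_Suc_conv_app_nth flip: Cons_nth_drop_Suc)
        then show ?thesis using word_prod_split[OF uc, of "n - 1" n] u0 n by simp
      qed
      obtain v where v: "v \<in> conj_class G x" "g\<^sub>0 = inv (word_prod G u) \<otimes> v"
        using component_chainE[OF f n(2) u(3)] by blast
      from cs show "\<exists>v\<in>conj_class G x. g = inv (word_prod G w) \<otimes> v"
      proof cases
        case 1
        then have "w = seg u 2 n" "g = g\<^sub>0 \<otimes> u ! 0" by (auto simp: gchain_nonzero)
        then have "g = inv (word_prod G w) \<otimes> (inv (u ! 0) \<otimes> (v \<otimes> u ! 0))"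
          using v uc u0 closed by (simp add: s0 m_assoc inv_mult_group)
        then show ?thesis using conj_class_conj_inv[OF x v(1) u0(1)] by blast
      next
        case 2
        then obtain i where i: "i \<in> {1..n-1}" "gchain G (gsingle g\<^sub>0) (merge_at G u i) w g \<noteq> (0 :: 'k)"
          by (auto elim: sum_nonzeroE)
        then have "w = merge_at G u i" "g = g\<^sub>0" by (auto simp: gchain_nonzero)
        moreover have "i < length u" using i(1) uc n by auto
        ultimately show ?thesis using word_prod_merge_at[OF uc(1), of i] i(1) v by auto
      next
        case 3
        then have "w = seg u 1 (n - 1)" "g = u ! (n - 1) \<otimes> g\<^sub>0" by (auto simp: gchain_nonzero)
        then have "g = inv (word_prod G w) \<otimes> v"
          using v uc u0 closed by (simp add: sn m_assoc inv_mult_group)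
        then show ?thesis using v by blast
      qed
    qed
  qed
qed

text \<open>
  In all six cases the letters of the argument from the component of \<open>1\<close> cancel.  When a cochain
  swallows a whole chain on its right, the summation letter conjugates the holonomy of that chain;
  in the other cases the holonomy of \<open>b\<close> is unchanged.
\<close>

lemma th_cup_component:
  fixes a b :: "('a, 'k::field) thvec"
  assumes x: "x \<in> carrier G"
    and a: "a \<in> th_component G \<one> p" and b: "b \<in> th_component G x q"
    and space: "th_cup G (p, a) (q, b) \<in> th_space G (p + q)"
  shows "th_cup G (p, a) (q, b) \<in> th_component G x (p + q)"
proof -
  note closed = conj_class_closed[OF x]
  consider "0 \<le> p" "0 \<le> q" | "p < 0" "q < 0"
    | "0 \<le> p" "q < 0" "tate_len p \<le> tate_len q" | "0 \<le> p" "q < 0" "\<not> tate_len p \<le> tate_len q"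
    | "p < 0" "0 \<le> q" "tate_len q \<le> tate_len p" | "p < 0" "0 \<le> q" "\<not> tate_len q \<le> tate_len p"
    by linarith
  then show ?thesis
  proof cases
    case 1
    define n m where "n = tate_len p" and "m = tate_len q"
    show ?thesis
    proof (rule component_cochainI[OF x space])
      show "0 \<le> p + q" using 1 by simp
      fix w g
      assume nz: "th_cup G (p, a) (q, b) w g \<noteq> 0" and w: "set w \<subseteq> carrier G"
        and "length w = tate_len (p + q)"
      then have len: "length w = n + m" using 1 by (simp add: tate_len_def n_def m_def)
      have "gmult G (a (seg w 1 n)) (b (seg w (n + 1) (n + m))) g \<noteq> 0"
        using nz 1 by (simp add: th_cup_def Let_def n_def m_def cochain_def split: if_splits)
      then obtain h h' where h: "g = h \<otimes> h'" "a (seg w 1 n) h \<noteq> 0" "b (seg w (n + 1) (n + m)) h' \<noteq> 0"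
        by (rule gmult_nonzeroE)
      obtain v where v: "v \<in> conj_class G x" "h' = word_prod G (seg w (n + 1) (n + m)) \<otimes> v"
        using component_cochainE[OF b 1(2) h(3)] by blast
      have "g = word_prod G w \<otimes> v"
        using h(1) component_one_cochain[OF a 1(1) h(2)] v w closed[OF v(1)]
          word_prod_split[OF w len, of n "n + 1"] by (simp add: m_assoc)
      then show "\<exists>v\<in>conj_class G x. g = word_prod G w \<otimes> v" using v(1) by blast
    qed
  next
    case 2
    show ?thesis
    proof (rule component_chainI[OF x space])
      show "p + q < 0" using 2 by simp
      fix w g
      assume nz: "th_cup G (p, a) (q, b) w g \<noteq> 0"
      have "chain_extend G (tate_len p) (\<lambda>g\<^sub>0 gs. chain_extend G (tate_len q) (\<lambda>h\<^sub>0 hs.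
          \<Sum>g\<in>carrier G.
            gchain G (gsingle (g \<otimes> h\<^sub>0)) (hs @ [inv g \<otimes> g\<^sub>0] @ gs)) b) a w g \<noteq> 0"
        using nz 2 by (simp add: th_cup_def Let_def)
      then obtain gs g\<^sub>0 where g0: "a gs g\<^sub>0 \<noteq> 0" and "chain_extend G (tate_len q) (\<lambda>h\<^sub>0 hs.
          \<Sum>g\<in>carrier G. gchain G (gsingle (g \<otimes> h\<^sub>0)) (hs @ [inv g \<otimes> g\<^sub>0] @ gs)) b w g \<noteq> 0"
        by (rule chain_extend_nonzeroE)
      from this(2) obtain hs h\<^sub>0 where h0: "b hs h\<^sub>0 \<noteq> 0"
        and "(\<Sum>g\<in>carrier G. gchain G (gsingle (g \<otimes> h\<^sub>0)) (hs @ [inv g \<otimes> g\<^sub>0] @ gs)) w g \<noteq> (0 :: 'k)"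
        by (rule chain_extend_nonzeroE)
      then obtain k where k: "k \<in> carrier G"
        "gchain G (gsingle (k \<otimes> h\<^sub>0)) (hs @ [inv k \<otimes> g\<^sub>0] @ gs) w g \<noteq> (0 :: 'k)"
        unfolding sum_vec_apply by (blast elim: sum_nonzeroE)
      then have wg: "w = hs @ [inv k \<otimes> g\<^sub>0] @ gs" "g = k \<otimes> h\<^sub>0" by (auto simp: gchain_nonzero)
      obtain v where v: "v \<in> conj_class G x" "h\<^sub>0 = inv (word_prod G hs) \<otimes> v"
        using component_chainE[OF b 2(2) h0] by blast
      have "g = inv (word_prod G w) \<otimes> v"
        using wg component_one_chain[OF a 2(1) g0] v k component_carrier[OF b h0]
          closed[OF v(1)] by (simp add: m_assoc inv_mult_group)
      then show "\<exists>v\<in>conj_class G x. g = inv (word_prod G w) \<otimes> v" using v(1) by blast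
    qed
  next
    case 3
    define n t where "n = tate_len p" and "t = tate_len q"
    have nt: "n \<le> t" using 3 by (simp add: n_def t_def)
    show ?thesis
    proof (rule component_chainI[OF x space])
      show "p + q < 0" using 3 by (simp add: tate_len_def)
      fix w g
      assume nz: "th_cup G (p, a) (q, b) w g \<noteq> 0"
      have "chain_extend G t (\<lambda>h\<^sub>0 hs.
          gchain G (gmult G (a (seg hs (t - n + 1) t)) (gsingle h\<^sub>0)) (seg hs 1 (t - n))) b w g \<noteq> 0"
        using nz 3 by (simp add: th_cup_def Let_def n_def t_def)
      then obtain hs h\<^sub>0 where h0: "b hs h\<^sub>0 \<noteq> 0"
        and "gchain G (gmult G (a (seg hs (t - n + 1) t)) (gsingle h\<^sub>0)) (seg hs 1 (t - n)) w g \<noteq> 0"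
        by (rule chain_extend_nonzeroE)
      then have w: "w = seg hs 1 (t - n)" and "gmult G (a (seg hs (t - n + 1) t)) (gsingle h\<^sub>0) g \<noteq> 0"
        by (auto simp: gchain_nonzero)
      from this(2) obtain h where h: "g = h \<otimes> h\<^sub>0" "a (seg hs (t - n + 1) t) h \<noteq> 0"
        by (auto elim: gmult_nonzeroE)
      obtain v where v: "v \<in> conj_class G x" "h\<^sub>0 = inv (word_prod G hs) \<otimes> v"
        using component_chainE[OF b 3(2) h0] by blast
      have hs: "set hs \<subseteq> carrier G" "length hs = t" using component_carrier[OF b h0] by (auto simp: t_def)
      have "g = inv (word_prod G w) \<otimes> v"
        using w h(1) component_one_cochain[OF a 3(1) h(2)] v hs closed[OF v(1)]
          word_prod_split[OF hs, of "t - n" "t - n + 1"] nt by (simp add: m_assoc inv_mult_group)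
      then show "\<exists>v\<in>conj_class G x. g = inv (word_prod G w) \<otimes> v" using v(1) by blast
    qed
  next
    case 4
    define n t where "n = tate_len p" and "t = tate_len q"
    show ?thesis
    proof (rule component_cochainI[OF x space])
      show "0 \<le> p + q" using 4 by (simp add: tate_len_def)
      fix w g
      assume nz: "th_cup G (p, a) (q, b) w g \<noteq> 0" and w: "set w \<subseteq> carrier G"
      have "chain_extend G t (\<lambda>g\<^sub>0 gs. cochain G (n - t - 1) (\<lambda>hs.
            \<Sum>g\<in>carrier G. gmult G (a (hs @ [inv g] @ gs)) (gsingle (g\<^sub>0 \<otimes> g)))) b w g \<noteq> 0"
        using nz 4 by (simp add: th_cup_def Let_def n_def t_def)
      then obtain gs g\<^sub>0 where g0: "b gs g\<^sub>0 \<noteq> 0" and "cochain G (n - t - 1) (\<lambda>hs.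
            \<Sum>g\<in>carrier G. gmult G (a (hs @ [inv g] @ gs)) (gsingle (g\<^sub>0 \<otimes> g))) w g \<noteq> 0"
        by (rule chain_extend_nonzeroE)
      then have "(\<Sum>k\<in>carrier G. gmult G (a (w @ [inv k] @ gs)) (gsingle (g\<^sub>0 \<otimes> k)) g) \<noteq> 0"
        by (simp add: cochain_nonzero sum_vec_apply)
      then obtain k where k: "k \<in> carrier G" "gmult G (a (w @ [inv k] @ gs)) (gsingle (g\<^sub>0 \<otimes> k)) g \<noteq> 0"
        by (rule sum_nonzeroE)
      from k(2) obtain h where h: "g = h \<otimes> (g\<^sub>0 \<otimes> k)" "a (w @ [inv k] @ gs) h \<noteq> 0"
        by (auto elim: gmult_nonzeroE)
      obtain v where v: "v \<in> conj_class G x" "g\<^sub>0 = inv (word_prod G gs) \<otimes> v"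
        using component_chainE[OF b 4(2) g0] by blast
      have "g = word_prod G w \<otimes> (inv k \<otimes> (v \<otimes> k))"
        using h(1) component_one_cochain[OF a 4(1) h(2)] v k w closed[OF v(1)]
          component_carrier[OF b g0] by (simp add: m_assoc)
      then show "\<exists>v\<in>conj_class G x. g = word_prod G w \<otimes> v"
        using conj_class_conj_inv[OF x v(1) k(1)] by blast
    qed
  next
    case 5
    define s m where "s = tate_len p" and "m = tate_len q"
    have ms: "m \<le> s" using 5 by (simp add: m_def s_def)
    show ?thesis
    proof (rule component_chainI[OF x space])
      show "p + q < 0" using 5 by (simp add: tate_len_def)
      fix w g
      assume nz: "th_cup G (p, a) (q, b) w g \<noteq> 0"
      have "chain_extend G s (\<lambda>g\<^sub>0 gs.
            gchain G (gmult G (gsingle g\<^sub>0) (b (seg gs 1 m))) (seg gs (m + 1) s)) a w g \<noteq> 0"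
        using nz 5 by (simp add: th_cup_def Let_def s_def m_def)
      then obtain gs g\<^sub>0 where g0: "a gs g\<^sub>0 \<noteq> 0"
        and "gchain G (gmult G (gsingle g\<^sub>0) (b (seg gs 1 m))) (seg gs (m + 1) s) w g \<noteq> 0"
        by (rule chain_extend_nonzeroE)
      then have w: "w = seg gs (m + 1) s" and "gmult G (gsingle g\<^sub>0) (b (seg gs 1 m)) g \<noteq> 0"
        by (auto simp: gchain_nonzero)
      from this(2) obtain h where h: "g = g\<^sub>0 \<otimes> h" "b (seg gs 1 m) h \<noteq> 0"
        by (auto elim: gmult_nonzeroE)
      obtain v where v: "v \<in> conj_class G x" "h = word_prod G (seg gs 1 m) \<otimes> v"
        using component_cochainE[OF b 5(2) h(2)] by blast
      have gs: "set gs \<subseteq> carrier G" "length gs = s" using component_carrier[OF a g0] by (auto simp: s_def)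
      have "g = inv (word_prod G w) \<otimes> v"
        using w h(1) component_one_chain[OF a 5(1) g0] v gs closed[OF v(1)]
          word_prod_split[OF gs, of m "m + 1"] ms by (simp add: m_assoc inv_mult_group)
      then show "\<exists>v\<in>conj_class G x. g = inv (word_prod G w) \<otimes> v" using v(1) by blast
    qed
  next
    case 6
    define s m where "s = tate_len p" and "m = tate_len q"
    show ?thesis
    proof (rule component_cochainI[OF x space])
      show "0 \<le> p + q" using 6 by (simp add: tate_len_def)
      fix w g
      assume nz: "th_cup G (p, a) (q, b) w g \<noteq> 0" and w: "set w \<subseteq> carrier G"
      have "chain_extend G s (\<lambda>g\<^sub>0 gs. cochain G (m - s - 1) (\<lambda>hs.
            \<Sum>g\<in>carrier G. gmult G (gsingle (g \<otimes> g\<^sub>0)) (b (gs @ [inv g] @ hs)))) a w g \<noteq> 0"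
        using nz 6 by (simp add: th_cup_def Let_def m_def s_def)
      then obtain gs g\<^sub>0 where g0: "a gs g\<^sub>0 \<noteq> 0" and "cochain G (m - s - 1) (\<lambda>hs.
            \<Sum>g\<in>carrier G. gmult G (gsingle (g \<otimes> g\<^sub>0)) (b (gs @ [inv g] @ hs))) w g \<noteq> 0"
        by (rule chain_extend_nonzeroE)
      then have "(\<Sum>k\<in>carrier G. gmult G (gsingle (k \<otimes> g\<^sub>0)) (b (gs @ [inv k] @ w)) g) \<noteq> 0"
        by (simp add: cochain_nonzero sum_vec_apply)
      then obtain k where k: "k \<in> carrier G" "gmult G (gsingle (k \<otimes> g\<^sub>0)) (b (gs @ [inv k] @ w)) g \<noteq> 0"
        by (rule sum_nonzeroE)
      from k(2) obtain h where h: "g = (k \<otimes> g\<^sub>0) \<otimes> h" "b (gs @ [inv k] @ w) h \<noteq> 0"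
        by (auto elim: gmult_nonzeroE)
      obtain v where v: "v \<in> conj_class G x" "h = word_prod G (gs @ [inv k] @ w) \<otimes> v"
        using component_cochainE[OF b 6(2) h(2)] by blast
      have "g = word_prod G w \<otimes> v"
        using h(1) component_one_chain[OF a 6(1) g0] v k w closed[OF v(1)] by (simp add: m_assoc)
      then show "\<exists>v\<in>conj_class G x. g = word_prod G w \<otimes> v" using v(1) by blast
    qed
  qed
qed

text \<open>
  For cochain, chain, cochain the subwords of the middle chain \<open>(g\<^sub>0, g\<^sub>1, \<dots>, g\<^sub>r)\<close> appear in the cyclic
  order \<open>g\<^sub>j \<cdots> g\<^sub>r g\<^sub>0 g\<^sub>1 \<cdots> g\<^sub>j\<^sub>-\<^sub>1\<close>, whose product is \<open>1\<close>; then \<open>g\<close> meets \<open>g\<inverse>\<close>.  For chain, cochain,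
  chain the holonomy of the result is the product of its word, which ends in a final segment of the
  first chain, and its coefficient, which starts with \<open>g\<^sub>0\<close> and the complementary initial segment; so the
  first chain cancels in the same way.
\<close>

lemma th_m3_component:
  fixes a b c :: "('a, 'k::field) thvec"
  assumes x: "x \<in> carrier G"
    and a: "a \<in> th_component G \<one> p" and b: "b \<in> th_component G \<one> q"
    and c: "c \<in> th_component G x l"
    and space: "th_m3 G (p, a) (q, b) (l, c) \<in> th_space G (p + q + l - 1)"
  shows "th_m3 G (p, a) (q, b) (l, c) \<in> th_component G x (p + q + l - 1)"
proof -
  note closed = conj_class_closed[OF x]
  consider "0 \<le> p" "q < 0" "0 \<le> l" "tate_len q + 2 \<le> tate_len p + tate_len l"
    | "p < 0" "0 \<le> q" "l < 0" "tate_len q \<le> tate_len p + tate_len l + 1"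
    | "th_m3 G (p, a) (q, b) (l, c) = 0"
    unfolding th_m3_def Let_def prod.case by (meson linorder_not_less)
  then show ?thesis
  proof cases
    case 1
    define m r n where "m = tate_len p" and "r = tate_len q" and "n = tate_len l"
    show ?thesis
    proof (rule component_cochainI[OF x space])
      show "0 \<le> p + q + l - 1" using 1 by (simp add: tate_len_def)
      fix w u
      assume nz: "th_m3 G (p, a) (q, b) (l, c) w u \<noteq> 0" and w: "set w \<subseteq> carrier G"
        and "length w = tate_len (p + q + l - 1)"
      then have len: "length w = m + n - r - 2"
        using 1 by (simp add: tate_len_def m_def n_def r_def split: if_splits)
      have "chain_extend G r (\<lambda>g\<^sub>0 gs. cochain G (m + n - r - 2) (\<lambda>hs u.
            \<Sum>g\<in>carrier G. \<Sum>j\<in>{j. 1 \<le> j \<and> j \<le> min n (r + 1) \<and> r + 2 \<le> m + j}.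
              (-1) ^ (m + r + j - 1) *
              gmult G
                (gmult G (a (seg hs 1 (m + j - r - 2) @ [g] @ seg gs j r)) (gsingle g\<^sub>0))
                (c (seg gs 1 (j - 1) @ [inv g] @ seg hs (m + j - r - 1) (m + n - r - 2))) u)) b w u
        \<noteq> 0"
        using nz 1 unfolding m_def r_def n_def by (simp add: th_m3_def Let_def)
      then obtain gs g\<^sub>0 where g0: "b gs g\<^sub>0 \<noteq> 0" and
         "cochain G (m + n - r - 2) (\<lambda>hs u.
            \<Sum>g\<in>carrier G. \<Sum>j\<in>{j. 1 \<le> j \<and> j \<le> min n (r + 1) \<and> r + 2 \<le> m + j}.
              (-1) ^ (m + r + j - 1) *
              gmult G
                (gmult G (a (seg hs 1 (m + j - r - 2) @ [g] @ seg gs j r)) (gsingle g\<^sub>0))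
                (c (seg gs 1 (j - 1) @ [inv g] @ seg hs (m + j - r - 1) (m + n - r - 2))) u) w u \<noteq> 0"
        by (rule chain_extend_nonzeroE)
      from this(2) have "(\<Sum>g\<in>carrier G. \<Sum>j\<in>{j. 1 \<le> j \<and> j \<le> min n (r + 1) \<and> r + 2 \<le> m + j}.
              (-1) ^ (m + r + j - 1) *
              gmult G
                (gmult G (a (seg w 1 (m + j - r - 2) @ [g] @ seg gs j r)) (gsingle g\<^sub>0))
                (c (seg gs 1 (j - 1) @ [inv g] @ seg w (m + j - r - 1) (m + n - r - 2))) u) \<noteq> 0"
        by (simp add: cochain_nonzero)
      then obtain g where g: "g \<in> carrier G" and
        "(\<Sum>j\<in>{j. 1 \<le> j \<and> j \<le> min n (r + 1) \<and> r + 2 \<le> m + j}.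
              (-1) ^ (m + r + j - 1) *
              gmult G
                (gmult G (a (seg w 1 (m + j - r - 2) @ [g] @ seg gs j r)) (gsingle g\<^sub>0))
                (c (seg gs 1 (j - 1) @ [inv g] @ seg w (m + j - r - 1) (m + n - r - 2))) u) \<noteq> 0"
        by (rule sum_nonzeroE)
      from this(2) obtain j where j: "1 \<le> j" "j \<le> n" "j \<le> r + 1" "r + 2 \<le> m + j" and
        "gmult G
                (gmult G (a (seg w 1 (m + j - r - 2) @ [g] @ seg gs j r)) (gsingle g\<^sub>0))
                (c (seg gs 1 (j - 1) @ [inv g] @ seg w (m + j - r - 1) (m + n - r - 2))) u \<noteq> 0"
        by (auto elim!: sum_nonzeroE)
      from this(5) obtain h h' where u: "u = h \<otimes> h'"
        and h: "gmult G (a (seg w 1 (m + j - r - 2) @ [g] @ seg gs j r)) (gsingle g\<^sub>0) h \<noteq> 0"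
        and h': "c (seg gs 1 (j - 1) @ [inv g] @ seg w (m + j - r - 1) (m + n - r - 2)) h' \<noteq> 0"
        by (rule gmult_nonzeroE)
      from h obtain f where f: "h = f \<otimes> g\<^sub>0" "a (seg w 1 (m + j - r - 2) @ [g] @ seg gs j r) f \<noteq> 0"
        by (auto elim: gmult_nonzeroE)
      have gs: "set gs \<subseteq> carrier G" "length gs = r" using component_carrier[OF b g0] by (auto simp: r_def)
      have split_gs: "word_prod G gs = word_prod G (seg gs 1 (j - 1)) \<otimes> word_prod G (seg gs j r)"
        using word_prod_split[OF gs, of "j - 1" j] j by simp
      have split_w: "word_prod G w = word_prod G (seg w 1 (m + j - r - 2))
          \<otimes> word_prod G (seg w (m + j - r - 1) (m + n - r - 2))"
        using word_prod_split[OF w len, of "m + j - r - 2" "m + j - r - 1"] j by linarith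
      obtain v where v: "v \<in> conj_class G x"
        "h' = word_prod G (seg gs 1 (j - 1) @ [inv g] @ seg w (m + j - r - 1) (m + n - r - 2)) \<otimes> v"
        using component_cochainE[OF c 1(3) h'] by blast
      have "u = word_prod G w \<otimes> v"
        unfolding u f(1) component_one_cochain(2)[OF a 1(1) f(2)] component_one_chain(2)[OF b 1(2) g0] v(2)
          split_w split_gs
        using w gs g closed[OF v(1)] by (simp add: m_assoc inv_mult_group seg_carrier)
      then show "\<exists>v\<in>conj_class G x. u = word_prod G w \<otimes> v" using v(1) by blast
    qed
  next
    case 2
    define r m s where "r = tate_len p" and "m = tate_len q" and "s = tate_len l"
    show ?thesis
    proof (rule component_chainI[OF x space])
      show "p + q + l - 1 < 0" using 2 by (simp add: tate_len_def)
      fix w u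
      assume nz: "th_m3 G (p, a) (q, b) (l, c) w u \<noteq> 0"
      have "chain_extend G r (\<lambda>g\<^sub>0 gs. chain_extend G s (\<lambda>h\<^sub>0 hs.
            \<Sum>g\<in>carrier G. \<Sum>j\<in>{j. j \<le> s \<and> s + 1 \<le> m + j \<and> m + j \<le> r + s + 1}.
              th_scale ((-1) ^ (r + s + m - j))
                (gchain G
                  (gmult G
                    (gmult G (gsingle g\<^sub>0) (b (seg gs 1 (m + j - s - 1) @ [g] @ seg hs (j + 1) s)))
                    (gsingle h\<^sub>0))
                  (seg hs 1 j @ [inv g] @ seg gs (m + j - s) r))) c) a w u \<noteq> 0"
        using nz 2 unfolding m_def r_def s_def by (simp add: th_m3_def Let_def)
      then obtain gs g\<^sub>0 where g0: "a gs g\<^sub>0 \<noteq> 0" and "chain_extend G s (\<lambda>h\<^sub>0 hs.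
            \<Sum>g\<in>carrier G. \<Sum>j\<in>{j. j \<le> s \<and> s + 1 \<le> m + j \<and> m + j \<le> r + s + 1}.
              th_scale ((-1) ^ (r + s + m - j))
                (gchain G
                  (gmult G
                    (gmult G (gsingle g\<^sub>0) (b (seg gs 1 (m + j - s - 1) @ [g] @ seg hs (j + 1) s)))
                    (gsingle h\<^sub>0))
                  (seg hs 1 j @ [inv g] @ seg gs (m + j - s) r))) c w u \<noteq> 0"
        by (rule chain_extend_nonzeroE)
      from this(2) obtain hs h\<^sub>0 where h0: "c hs h\<^sub>0 \<noteq> 0" and
        "(\<Sum>g\<in>carrier G. \<Sum>j\<in>{j. j \<le> s \<and> s + 1 \<le> m + j \<and> m + j \<le> r + s + 1}.
              th_scale ((-1) ^ (r + s + m - j))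
                (gchain G
                  (gmult G
                    (gmult G (gsingle g\<^sub>0) (b (seg gs 1 (m + j - s - 1) @ [g] @ seg hs (j + 1) s)))
                    (gsingle h\<^sub>0))
                  (seg hs 1 j @ [inv g] @ seg gs (m + j - s) r))) w u \<noteq> 0"
        by (rule chain_extend_nonzeroE)
      from this(2) obtain g where g: "g \<in> carrier G" and
        "(\<Sum>j\<in>{j. j \<le> s \<and> s + 1 \<le> m + j \<and> m + j \<le> r + s + 1}.
              th_scale ((-1) ^ (r + s + m - j))
                (gchain G
                  (gmult G
                    (gmult G (gsingle g\<^sub>0) (b (seg gs 1 (m + j - s - 1) @ [g] @ seg hs (j + 1) s)))
                    (gsingle h\<^sub>0))
                  (seg hs 1 j @ [inv g] @ seg gs (m + j - s) r)) w u) \<noteq> 0"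
        unfolding sum_vec_apply by (blast elim: sum_nonzeroE)
      from this(2) obtain j where j: "j \<le> s" "s + 1 \<le> m + j" "m + j \<le> r + s + 1" and
        "gchain G
                  (gmult G
                    (gmult G (gsingle g\<^sub>0) (b (seg gs 1 (m + j - s - 1) @ [g] @ seg hs (j + 1) s)))
                    (gsingle h\<^sub>0))
                  (seg hs 1 j @ [inv g] @ seg gs (m + j - s) r) w u \<noteq> 0"
        by (auto elim!: sum_nonzeroE simp: th_scale_def)
      from this(4) have w: "w = seg hs 1 j @ [inv g] @ seg gs (m + j - s) r"
        and "gmult G
                    (gmult G (gsingle g\<^sub>0) (b (seg gs 1 (m + j - s - 1) @ [g] @ seg hs (j + 1) s)))
                    (gsingle h\<^sub>0) u \<noteq> 0"
        unfolding gchain_nonzero by auto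
      from this(2) obtain h where u: "u = h \<otimes> h\<^sub>0"
        and "gmult G (gsingle g\<^sub>0) (b (seg gs 1 (m + j - s - 1) @ [g] @ seg hs (j + 1) s)) h \<noteq> 0"
        by (auto elim: gmult_nonzeroE)
      from this(2) obtain f where f: "h = g\<^sub>0 \<otimes> f"
        "b (seg gs 1 (m + j - s - 1) @ [g] @ seg hs (j + 1) s) f \<noteq> 0"
        by (auto elim: gmult_nonzeroE)
      have gs: "set gs \<subseteq> carrier G" "length gs = r" using component_carrier[OF a g0] by (auto simp: r_def)
      have hs: "set hs \<subseteq> carrier G" "length hs = s" using component_carrier[OF c h0] by (auto simp: s_def)
      have split_gs: "word_prod G gs = word_prod G (seg gs 1 (m + j - s - 1)) \<otimes> word_prod G (seg gs (m + j - s) r)"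
        using word_prod_split[OF gs, of "m + j - s - 1" "m + j - s"] j by linarith
      have split_hs: "word_prod G hs = word_prod G (seg hs 1 j) \<otimes> word_prod G (seg hs (j + 1) s)"
        using word_prod_split[OF hs, of j "j + 1"] j by simp
      obtain v where v: "v \<in> conj_class G x" "h\<^sub>0 = inv (word_prod G hs) \<otimes> v"
        using component_chainE[OF c 2(3) h0] by blast
      have "u = inv (word_prod G w) \<otimes> v"
        unfolding u w f(1) component_one_cochain(2)[OF b 2(2) f(2)] component_one_chain(2)[OF a 2(1) g0] v(2)
          split_hs split_gs
        using hs gs g closed[OF v(1)] by (simp add: m_assoc inv_mult_group seg_carrier)
      then show "\<exists>v\<in>conj_class G x. u = inv (word_prod G w) \<otimes> v" using v(1) by blast
    qed
  next
    case 3
    then show ?thesis by (simp add: component_zero)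
  qed
qed

text \<open>
  Closure in the uniform form that both the subalgebra (the case \<open>x = 1\<close>) and the modules need.  All
  operations of arity above three vanish.
\<close>

lemma th_op_component:
  fixes xs :: "(int \<times> ('a, 'k::field) thvec) list"
  assumes x: "x \<in> carrier G"
    and xs: "set xs \<subseteq> homog (th_component G \<one>)" and y: "y \<in> homog (th_component G x)"
    and space: "th_op G (length xs + 1) (xs @ [y]) \<in> th_space G (deg (xs @ [y]) + (2 - int (length xs + 1)))"
  shows "th_op G (length xs + 1) (xs @ [y]) \<in> th_component G x (deg (xs @ [y]) + (2 - int (length xs + 1)))"
proof -
  obtain l c where yc: "y = (l, c)" "c \<in> th_component G x l" using y by (auto simp: homog_def)
  consider "xs = []" | "length xs = 1" | "length xs = 2" | "length xs > 2"
    by (metis One_nat_def Suc_1 Suc_lessI length_greater_0_conv)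
  then show ?thesis
  proof cases
    case 1
    then show ?thesis using th_diff_component[OF x yc(2)] space by (simp add: yc(1) th_op_def deg_def)
  next
    case 2
    then obtain p a where "xs = [(p, a)]" by (auto simp: length_Suc_conv)
    then show ?thesis
      using th_cup_component[OF x _ yc(2), of a p] xs space
      by (simp add: yc(1) th_op_def deg_def homog_def)
  next
    case 3
    then obtain p a q b where "xs = [(p, a), (q, b)]" by (auto simp: length_Suc_conv numeral_2_eq_2)
    then show ?thesis
      using th_m3_component[OF x _ _ yc(2), of a p b q] xs space
      by (simp add: yc(1) th_op_def deg_def homog_def numeral_eq_Suc algebra_simps)
  next
    case 4
    then have "th_op G (length xs + 1) (xs @ [y]) = 0" by (auto simp: th_op_def)
    then show ?thesis by (simp only: component_zero)
  qed
qed


section \<open>Augmentation and the Tate complex\<close>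

text \<open>The augmentation \<open>kG \<rightarrow> k\<close> applied to the value, or the coefficient, at each word.\<close>

definition augment :: "('a, 'k::field) thvec \<Rightarrow> 'a list \<Rightarrow> 'k" where
  "augment f w = (\<Sum>g\<in>carrier G. f w g)"

lemma sum_gsingle:
  "finite (carrier G) \<Longrightarrow> h \<in> carrier G \<Longrightarrow> (\<Sum>g\<in>carrier G. gsingle h g) = (1 :: 'k::field)"
  by (simp add: gsingle_def)

lemma sum_gmult:
  fixes a b :: "'a \<Rightarrow> 'k::field"
  assumes "finite (carrier G)"
  shows "(\<Sum>g\<in>carrier G. gmult G a b g) = (\<Sum>g\<in>carrier G. a g) * (\<Sum>g\<in>carrier G. b g)"
proof -
  have "(\<Sum>g\<in>carrier G. gmult G a b g) =
      (\<Sum>h\<in>carrier G. \<Sum>h'\<in>carrier G. \<Sum>g\<in>carrier G. if h \<otimes> h' = g then a h * b h' else 0)"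
    unfolding gmult_def by (subst sum.swap, rule sum.cong[OF refl], rule sum.swap)
  also have "\<dots> = (\<Sum>h\<in>carrier G. \<Sum>h'\<in>carrier G. a h * b h')"
    using assms by (intro sum.cong refl) simp
  finally show ?thesis by (simp add: sum_product)
qed

lemma sum_gchain:
  assumes "finite (carrier G)" "h \<in> carrier G"
  shows "(\<Sum>g\<in>carrier G. gchain G (gsingle h) u v g) = (word_chain G u v :: 'k::field)"
  using sum_gsingle[OF assms] by (cases "v = u \<and> \<one> \<notin> set u") (auto simp: gchain_def word_chain_def)

lemma augment_th_space: "f \<in> th_space G p \<Longrightarrow> augment f \<in> tate_space G p"
  by (auto simp: augment_def th_space_def tate_space_def elim!: sum_nonzeroE)

lemma augment_hoch_codiff:
  fixes f :: "('a, 'k::field) thvec"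
  assumes fin: "finite (carrier G)"
  shows "augment (hoch_codiff G n f) = group_codiff G n (augment f)"
proof
  fix w
  have "w ! 0 \<in> carrier G" "w ! n \<in> carrier G" if "w \<in> bar_words G (n + 1)"
    using that by (auto simp: bar_words_def subset_iff)
  moreover have "(\<Sum>g\<in>carrier G. \<Sum>i=1..n. (-1) ^ i * f (merge_at G w i) g) =
      (\<Sum>i=1..n. (-1) ^ i * (\<Sum>g\<in>carrier G. f (merge_at G w i) g))"
    unfolding sum_distrib_left by (rule sum.swap)
  ultimately show "augment (hoch_codiff G n f) w = group_codiff G n (augment f) w"
    by (simp add: augment_def hoch_codiff_def group_codiff_def cochain_def sum.distrib sum_subtractf
        sum_gmult[OF fin] sum_gsingle[OF fin] flip: sum_distrib_left)
qed

lemma augment_chain_extend: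
  fixes c :: "('a, 'k::field) thvec"
  assumes "\<And>w g\<^sub>0. w \<in> bar_words G s \<Longrightarrow> g\<^sub>0 \<in> carrier G \<Longrightarrow> augment (F g\<^sub>0 w) v = E w v"
  shows "augment (chain_extend G s F c) v = (\<Sum>w\<in>bar_words G s. augment c w * E w v)"
proof -
  have "augment (chain_extend G s F c) v =
      (\<Sum>w\<in>bar_words G s. \<Sum>g\<in>carrier G. \<Sum>g\<^sub>0\<in>carrier G. c w g\<^sub>0 * F g\<^sub>0 w v g)"
    unfolding augment_def chain_extend_apply by (rule sum.swap)
  also have "\<dots> = (\<Sum>w\<in>bar_words G s. \<Sum>g\<^sub>0\<in>carrier G. c w g\<^sub>0 * augment (F g\<^sub>0 w) v)"
    unfolding augment_def sum_distrib_left by (rule sum.cong[OF refl], rule sum.swap)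
  also have "\<dots> = (\<Sum>w\<in>bar_words G s. augment c w * E w v)"
    unfolding augment_def sum_distrib_right
    by (intro sum.cong refl) (simp add: assms[unfolded augment_def])
  finally show ?thesis .
qed

lemma augment_hoch_diff:
  fixes f :: "('a, 'k::field) thvec"
  assumes fin: "finite (carrier G)" and n: "1 \<le> n"
  shows "augment (hoch_diff G n f) = group_diff G n (augment f)"
proof
  fix v
  let ?E = "\<lambda>w. word_chain G (seg w 2 n) +
      (\<Sum>i=1..n-1. tate_scale ((-1) ^ i) (word_chain G (merge_at G w i))) +
      tate_scale ((-1) ^ n) (word_chain G (seg w 1 (n - 1))) :: 'a list \<Rightarrow> 'k"
  have "augment (hoch_diff G n f) v = (\<Sum>w\<in>bar_words G n. augment f w * ?E w v)"
    unfolding hoch_diff_def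
  proof (rule augment_chain_extend)
    fix w g\<^sub>0 assume w: "w \<in> bar_words G n" and g0: "g\<^sub>0 \<in> carrier G"
    have "w ! 0 \<in> carrier G" "w ! (n - 1) \<in> carrier G"
      using w n by (auto simp: bar_words_def subset_iff)
    then show "augment (gchain G (gsingle (g\<^sub>0 \<otimes> w ! 0)) (seg w 2 n) +
        (\<Sum>i=1..n-1. th_scale ((-1) ^ i) (gchain G (gsingle g\<^sub>0) (merge_at G w i))) +
        th_scale ((-1) ^ n) (gchain G (gsingle (w ! (n - 1) \<otimes> g\<^sub>0)) (seg w 1 (n - 1)))) v = ?E w v"
      using g0
      by (simp add: augment_def sum_vec_apply th_scale_def tate_scale_def sum.distrib sum_gchain[OF fin]
          sum.swap[of _ "{Suc 0..n - Suc 0}"] flip: sum_distrib_left)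
  qed
  also have "\<dots> = group_diff G n (augment f) v"
    by (simp add: group_diff_def sum_vec_apply tate_scale_def)
  finally show "augment (hoch_diff G n f) v = group_diff G n (augment f) v" .
qed

lemma augment_hoch_norm:
  fixes f :: "('a, 'k::field) thvec"
  assumes fin: "finite (carrier G)" and f: "f \<in> th_space G (-1)"
  shows "augment (hoch_norm G f) = tate_scale (of_nat (order G)) (augment f)"
proof
  fix v
  have b0: "bar_words G 0 = {[]}" by (auto simp: bar_words_def)
  have "augment (hoch_norm G f) v =
      (\<Sum>w\<in>bar_words G 0. augment f w * (if v = [] then of_nat (order G) else 0))"
    unfolding hoch_norm_def
  proof (rule augment_chain_extend)
    fix w :: "'a list" and h assume h: "h \<in> carrier G"
    have "(\<Sum>x\<in>carrier G. \<Sum>g\<in>carrier G. gsingle (g \<otimes> h \<otimes> inv g) x) = (of_nat (order G) :: 'k)"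
      by (subst sum.swap) (simp add: sum_gsingle[OF fin] h order_def)
    then show "augment (cochain G 0 (\<lambda>_. \<Sum>g\<in>carrier G. gsingle (g \<otimes> h \<otimes> inv g))) v
        = (if v = [] then of_nat (order G) else (0 :: 'k))"
      by (simp add: augment_def cochain_def b0 sum_vec_apply)
  qed
  moreover have "augment f v = 0" if "v \<noteq> []"
  proof -
    have "f v g = 0" for g using f that by (auto simp: th_space_def bar_words_def tate_len_def)
    then show ?thesis by (simp add: augment_def)
  qed
  ultimately show "augment (hoch_norm G f) v = tate_scale (of_nat (order G)) (augment f) v"
    by (auto simp: b0 tate_scale_def)
qed

text \<open>
  The augmentation kills the difference between left, right and trivial multiplication by a group
  element, so it turns the Hochschild differentials into those with trivial coefficients, and the sum
  over conjugates into multiplication by the order of \<open>G\<close>.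
\<close>

lemma augment_th_diff:
  fixes f :: "('a, 'k::field) thvec"
  assumes fin: "finite (carrier G)" and f: "f \<in> th_space G p"
  shows "augment (th_diff G p f) = tate_diff G p (augment f)"
proof -
  have sc: "augment (th_scale c h) = tate_scale c (augment h)" for c and h :: "('a, 'k) thvec"
    by (auto simp: augment_def th_scale_def tate_scale_def sum_distrib_left)
  consider "0 \<le> p" | "p = -1" | "p < -1" by linarith
  then show ?thesis
  proof cases
    case 1
    then show ?thesis by (simp add: th_diff_def tate_diff_def augment_hoch_codiff[OF fin])
  next
    case 2
    then show ?thesis using f by (simp add: th_diff_def tate_diff_def augment_hoch_norm[OF fin])
  next
    case 3
    then have "1 \<le> tate_len p" by (simp add: tate_len_def)
    then show ?thesis using 3 by (simp add: th_diff_def tate_diff_def augment_hoch_diff[OF fin] sc)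
  qed
qed

text \<open>
  On cochains and on chains alike, \<open>\<iota>\<close> places the value at a word on the single group element that
  gives holonomy \<open>1\<close>.
\<close>

lemma tate_iota_apply:
  assumes "finite (carrier G)"
  shows "tate_iota G p f w g =
    (if w \<in> bar_words G (tate_len p) \<and> g = (if 0 \<le> p then word_prod G w else inv_word_prod G w)
     then f w else (0 :: 'k::field))"
proof (cases "0 \<le> p")
  case True
  then show ?thesis by (simp add: tate_iota_def cochain_def gsingle_def)
next
  case False
  have "tate_iota G p f w g = (\<Sum>v\<in>bar_words G (tate_len p).
      if v = w then f w * gsingle (inv_word_prod G w) g else 0)"
    using False
    by (auto simp: tate_iota_def sum_vec_apply th_scale_def gchain_def bar_words_def intro!: sum.cong)
  then show ?thesis using False finite_bar_words[OF assms] by (auto simp: gsingle_def)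
qed

lemma augment_tate_iota:
  fixes f :: "'a list \<Rightarrow> 'k::field"
  assumes fin: "finite (carrier G)" and f: "f \<in> tate_space G p"
  shows "augment (tate_iota G p f) = f"
proof
  fix w
  show "augment (tate_iota G p f) w = f w"
  proof (cases "w \<in> bar_words G (tate_len p)")
    case True
    then have "word_prod G w \<in> carrier G" "inv_word_prod G w \<in> carrier G"
      by (simp_all add: bar_words_carrier inv_word_prod_eq)
    then show ?thesis using True fin by (simp add: augment_def tate_iota_apply)
  next
    case False
    then show ?thesis using f fin by (auto simp: augment_def tate_iota_apply tate_space_def)
  qed
qed

lemma tate_iota_component:
  fixes f :: "'a list \<Rightarrow> 'k::field"
  assumes "finite (carrier G)"
  shows "tate_iota G p f \<in> th_component G \<one> p"
  using assms
  by (auto simp: th_component_def th_space_def tate_iota_apply conj_class_one bar_words_carrier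
      inv_word_prod_eq split: if_splits)

text \<open>
  In the component of \<open>1\<close> the coefficient at a word is a multiple of a single group element, known in
  advance, so the augmentation loses nothing.
\<close>

lemma tate_iota_augment:
  fixes f :: "('a, 'k::field) thvec"
  assumes fin: "finite (carrier G)" and f: "f \<in> th_component G \<one> p"
  shows "tate_iota G p (augment f) = f"
proof (intro ext)
  fix w g
  let ?u = "if 0 \<le> p then word_prod G w else inv_word_prod G w"
  have supp: "w \<in> bar_words G (tate_len p) \<and> h = ?u" if "f w h \<noteq> 0" for h
  proof -
    have "w \<in> bar_words G (tate_len p)"
      using f that component_subset[of \<one> p] by (auto simp: th_space_def)
    then show ?thesis
      using component_one_cochain[OF f _ that] component_one_chain[OF f _ that]
      by (auto simp: inv_word_prod_eq)
  qed
  show "tate_iota G p (augment f) w g = f w g"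
  proof (cases "w \<in> bar_words G (tate_len p) \<and> g = ?u")
    case True
    then have "g \<in> carrier G" by (auto simp: bar_words_carrier inv_word_prod_eq)
    moreover have "f w h = 0" if "h \<noteq> g" for h using supp[of h] True that by blast
    ultimately have "augment f w = f w g"
      using fin by (simp add: augment_def sum.remove[of "carrier G" g])
    then show ?thesis using True by (simp add: tate_iota_apply[OF fin])
  next
    case False
    then show ?thesis using supp[of g] by (simp add: tate_iota_apply[OF fin]) metis
  qed
qed

lemma tate_image_eq:
  assumes fin: "finite (carrier G)"
  shows "(tate_image G p :: ('a, 'k::field) thvec set) = th_component G \<one> p"
proof
  show "(tate_image G p :: ('a, 'k) thvec set) \<subseteq> th_component G \<one> p"
    by (auto simp: tate_image_def tate_iota_component[OF fin])
  show "th_component G \<one> p \<subseteq> (tate_image G p :: ('a, 'k) thvec set)"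
    unfolding tate_image_def
    by (metis (no_types) augment_th_space component_subset fin imageI subset_iff tate_iota_augment)
qed

text \<open>
  Injectivity and compatibility with the differentials both come from the augmentation \<open>\<epsilon>\<close>: from
  \<open>\<epsilon> \<iota> = id\<close> one gets injectivity, and \<open>d \<iota> = \<iota> \<epsilon> d \<iota> = \<iota> d \<epsilon> \<iota> = \<iota> d\<close>, where the first step uses that \<open>d \<iota>\<close>
  takes values in the component of \<open>1\<close>.
\<close>

lemma tate_iota_embedding:
  assumes fin: "finite (carrier G)"
    and space: "\<And>p f. f \<in> th_space G p \<Longrightarrow> th_diff G p f \<in> (th_space G (p + 1) :: ('a, 'k::field) thvec set)"
  shows "complex_embedding tate_scale (tate_space G) (tate_diff G)
           (th_scale :: 'k \<Rightarrow> _) (th_space G) (th_diff G) (tate_iota G)"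
  unfolding complex_embedding_def
proof (intro allI conjI ballI)
  fix p
  show "tate_iota G p ` tate_space G p \<subseteq> (th_space G p :: ('a, 'k) thvec set)"
    using tate_iota_component[OF fin] component_subset by blast
  show "inj_on (tate_iota G p) (tate_space G p :: ('a list \<Rightarrow> 'k) set)"
    by (rule inj_on_inverseI[of _ augment]) (rule augment_tate_iota[OF fin])
next
  fix p c and a b :: "'a list \<Rightarrow> 'k"
  show "tate_iota G p (a + tate_scale c b) = tate_iota G p a + th_scale c (tate_iota G p b)"
    by (simp add: fun_eq_iff tate_iota_apply[OF fin] th_scale_def tate_scale_def)
next
  fix p and a :: "'a list \<Rightarrow> 'k" assume a: "a \<in> tate_space G p"
  let ?d = "th_diff G p (tate_iota G p a)"
  have i: "tate_iota G p a \<in> th_space G p" using tate_iota_component[OF fin] component_subset by blast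
  have d: "?d \<in> th_component G \<one> (p + 1)"
    by (rule th_diff_component[OF one_closed tate_iota_component[OF fin] space[OF i]])
  have *: "tate_diff G p a = augment ?d"
    by (simp add: augment_th_diff[OF fin i] augment_tate_iota[OF fin a])
  show "tate_diff G p a \<in> tate_space G (p + 1)" unfolding * by (rule augment_th_space[OF space[OF i]])
  show "tate_iota G (p + 1) (tate_diff G p a) = ?d" unfolding * by (rule tate_iota_augment[OF fin d])
qed


section \<open>The restricted pairing\<close>

lemma gpair_delta:
  assumes "finite (carrier G)" "h \<in> carrier G"
  shows "gpair G (\<lambda>g. if g = h then c else 0) (\<lambda>g. if g = inv h then d else 0) = c * (d :: 'k::field)"
proof -
  have "gpair G (\<lambda>g. if g = h then c else 0) (\<lambda>g. if g = inv h then d else 0) =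
      (\<Sum>g\<in>carrier G. if g = h then (\<Sum>k\<in>carrier G. if k = inv h then c * d else 0) else 0)"
    unfolding gpair_def using assms(2)
    by (auto simp: intro!: sum.cong cong: if_cong)
  then show ?thesis using assms by simp
qed

text \<open>
  Degree \<open>-p - 1\<close> is the one that \<open>th_pair\<close> pairs with degree \<open>p\<close>, and the coefficients of the two images
  at a word \<open>w\<close> sit on mutually inverse group elements.
\<close>

lemma th_pair_tate_iota:
  fixes f h :: "'a list \<Rightarrow> 'k::field"
  assumes fin: "finite (carrier G)"
  shows "th_pair G (p, tate_iota G p f) (- p - 1, tate_iota G (- p - 1) h) =
    (\<Sum>w\<in>bar_words G (tate_len p). f w * h w)"
proof -
  have row: "tate_iota G q e w = (\<lambda>g. if g = word_prod G w then e w else 0)" if "0 \<le> q"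
    and "w \<in> bar_words G (tate_len q)" for q w and e :: "'a list \<Rightarrow> 'k"
    using that by (simp add: tate_iota_apply[OF fin] fun_eq_iff)
  have row': "tate_iota G q e w = (\<lambda>g. if g = inv (word_prod G w) then e w else 0)" if "q < 0"
    and "w \<in> bar_words G (tate_len q)" for q w and e :: "'a list \<Rightarrow> 'k"
    using that by (simp add: tate_iota_apply[OF fin] fun_eq_iff inv_word_prod_eq bar_words_carrier)
  have wp: "word_prod G w \<in> carrier G" if "w \<in> bar_words G n" for w n
    using that by (simp add: bar_words_carrier)
  show ?thesis
  proof (cases "0 \<le> p")
    case True
    then show ?thesis
      using wp by (auto simp: th_pair_def row row' gpair_delta[OF fin] intro!: sum.cong)
  next
    case False
    then show ?thesis
      using wp by (auto simp: th_pair_def row row' gpair_delta[OF fin] mult.commute intro!: sum.cong)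
  qed
qed

text \<open>
  A nonzero value of an element at a word is detected by pairing with the image of the indicator
  function of that word, which again lies in the component of \<open>1\<close>.
\<close>

lemma nondegenerate_pairing_component_one:
  assumes fin: "finite (carrier G)"
    and nd: "nondegenerate_pairing (th_scale :: 'k::field \<Rightarrow> _) (th_space G) (th_pair G)"
  shows "nondegenerate_pairing (th_scale :: 'k \<Rightarrow> _) (th_component G \<one>) (th_pair G)"
proof -
  have "a = 0" if a: "a \<in> th_component G \<one> p"
      and z: "\<And>y. y \<in> homog (th_component G \<one>) \<Longrightarrow> th_pair G (p, a) y = 0 \<or> th_pair G y (p, a) = 0"
    for p and a :: "('a, 'k) thvec"
  proof -
    have "augment a w = 0" for w
    proof (cases "w \<in> bar_words G (tate_len p)")
      case True
      let ?d = "\<lambda>v. if v = w then 1 else (0 :: 'k)"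
      have ai: "tate_iota G p (augment a) = a" by (rule tate_iota_augment[OF fin a])
      have "th_pair G (p, a) (- p - 1, tate_iota G (- p - 1) ?d) = augment a w"
        using th_pair_tate_iota[OF fin, of p "augment a" ?d] True finite_bar_words[OF fin]
        by (simp add: ai if_distrib cong: if_cong)
      \<comment> \<open>The same formula read from degree \<open>-p - 1\<close>, whose partner is \<open>p\<close> again.\<close>
      moreover have "th_pair G (- p - 1, tate_iota G (- p - 1) ?d) (p, a) = augment a w"
        using th_pair_tate_iota[OF fin, of "- p - 1" ?d "augment a"] True finite_bar_words[OF fin]
        by (simp add: ai if_distrib[of "\<lambda>x. x * _"] cong: if_cong)
      moreover have "(- p - 1, tate_iota G (- p - 1) ?d) \<in> homog (th_component G \<one>)"
        using tate_iota_component[OF fin] by (simp add: homog_def)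
      ultimately show ?thesis using z by metis
    next
      case False
      then show ?thesis
        using augment_th_space[of a p] a component_subset by (fastforce simp: tate_space_def)
    qed
    then have "augment a = (\<lambda>_. 0)" by auto
    moreover have "tate_iota G p (\<lambda>_. 0 :: 'k) = 0"
      by (intro ext) (simp add: tate_iota_apply[OF fin])
    ultimately show ?thesis using tate_iota_augment[OF fin a] by simp
  qed
  then show ?thesis
    using nd component_subset[of \<one>] unfolding nondegenerate_pairing_def by (meson subset_iff)
qed

end


section \<open>Restricting A-infinity structures to closed subspaces\<close>

lemma homog_mono: "(\<And>p. B p \<subseteq> A p) \<Longrightarrow> homog B \<subseteq> homog A"
  by (auto simp: homog_def)

lemma list_all2_replicate_right:
  "list_all2 P xs (replicate n b) \<longleftrightarrow> length xs = n \<and> (\<forall>x\<in>set xs. P x b)"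
  by (auto simp: list_all2_conv_all_nth all_set_conv_all_nth)

text \<open>
  Multilinearity is inherited, so only the position of the values has to be checked.
\<close>

lemma graded_multilinear_restrict:
  assumes f: "graded_multilinear scale As A e f"
    and sub: "list_all2 (\<lambda>B A. \<forall>p. B p \<subseteq> A p) Bs As"
    and closed: "\<And>xs. list_all2 (\<lambda>x B. x \<in> homog B) xs Bs \<Longrightarrow> f xs \<in> B (deg xs + e)"
  shows "graded_multilinear scale Bs B e f"
  unfolding graded_multilinear_def
proof (intro allI impI conjI ballI)
  fix xs assume xs: "list_all2 (\<lambda>x B. x \<in> homog B) xs Bs"
  then show "f xs \<in> B (deg xs + e)" by (rule closed)
  fix i y c assume i: "i < length xs" and y: "y \<in> (Bs ! i) (fst (xs ! i))"
  have "list_all2 (\<lambda>x A. x \<in> homog A) xs As"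
    using xs sub by (fastforce simp: list_all2_conv_all_nth homog_def)
  moreover have "(Bs ! i) (fst (xs ! i)) \<subseteq> (As ! i) (fst (xs ! i))"
    using i xs sub by (simp add: list_all2_conv_all_nth)
  then have "y \<in> (As ! i) (fst (xs ! i))" using y by blast
  ultimately show "f (xs[i := (fst (xs ! i), snd (xs ! i) + scale c y)]) =
      f xs + scale c (f (xs[i := (fst (xs ! i), y)]))"
    using f i unfolding graded_multilinear_def by blast
qed

lemma graded_space_restrict:
  assumes "graded_space scale A"
    and "\<And>p. 0 \<in> B p" "\<And>p a b c. a \<in> B p \<Longrightarrow> b \<in> B p \<Longrightarrow> a + scale c b \<in> B p"
  shows "graded_space scale B"
proof -
  interpret vector_space scale using assms(1) by (simp add: graded_space_def)
  have "subspace (B p)" for p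
  proof (rule subspaceI)
    show "0 \<in> B p" by fact
    show "a + b \<in> B p" if "a \<in> B p" "b \<in> B p" for a b using assms(3)[OF that, of 1] by simp
    show "scale c a \<in> B p" if "a \<in> B p" for a c using assms(3)[OF assms(2) that, of c] by simp
  qed
  then show ?thesis using assms(1) by (simp add: graded_space_def)
qed

lemma ainf_algebra_restrict:
  fixes B :: "int \<Rightarrow> 'v::ab_group_add set"
  assumes m: "ainf_algebra scale A m" and B: "graded_space scale B" and sub: "\<And>p. B p \<subseteq> A p"
    and closed: "\<And>xs. xs \<noteq> [] \<Longrightarrow> set xs \<subseteq> homog B \<Longrightarrow>
      m (length xs) xs \<in> B (deg xs + (2 - int (length xs)))"
  shows "ainf_algebra scale B m"
  unfolding ainf_algebra_def
proof (intro conjI allI impI B)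
  fix i :: nat assume i: "1 \<le> i"
  show "graded_multilinear scale (replicate i B) B (2 - int i) (m i)"
  proof (rule graded_multilinear_restrict)
    show "graded_multilinear scale (replicate i A) A (2 - int i) (m i)"
      using m i by (simp add: ainf_algebra_def)
    show "list_all2 (\<lambda>B A. \<forall>p. B p \<subseteq> A p) (replicate i B) (replicate i A)"
      using sub by (simp add: list_all2_replicate_right)
    fix xs assume "list_all2 (\<lambda>x B. x \<in> homog B) xs (replicate i B)"
    then have "length xs = i" "set xs \<subseteq> homog B" by (auto simp: list_all2_replicate_right)
    then show "m i xs \<in> B (deg xs + (2 - int i))" using closed[of xs] i by fastforce
  qed
next
  fix n :: nat and xs :: "(int \<times> 'v) list"
  assume "1 \<le> n" "length xs = n \<and> set xs \<subseteq> homog B"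
  then show "(\<Sum>(r, s, t)\<in>{(r, s, t). r + s + t = n \<and> 1 \<le> s}. stasheff_term scale m m r s t xs) = 0"
    using m homog_mono[of B A, OF sub] unfolding ainf_algebra_def by blast
qed

text \<open>
  A closed subspace of an algebra on which a subalgebra acts through the ambient operations is a
  module: each module identity is an instance of a Stasheff identity of the ambient algebra.
\<close>

lemma ainf_module_restrict:
  fixes B :: "int \<Rightarrow> 'v::ab_group_add set"
  assumes m: "ainf_algebra scale A m" and B: "ainf_algebra scale B m" and M: "graded_space scale M"
    and subB: "\<And>p. B p \<subseteq> A p" and subM: "\<And>p. M p \<subseteq> A p"
    and closed: "\<And>xs y. set xs \<subseteq> homog B \<Longrightarrow> y \<in> homog M \<Longrightarrow>
      m (length xs + 1) (xs @ [y]) \<in> M (deg (xs @ [y]) + (2 - int (length xs + 1)))"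
  shows "ainf_module scale B m M m"
  unfolding ainf_module_def
proof (intro conjI allI impI B M)
  fix i :: nat assume i: "1 \<le> i"
  show "graded_multilinear scale (replicate (i - 1) B @ [M]) M (2 - int i) (m i)"
  proof (rule graded_multilinear_restrict)
    show "graded_multilinear scale (replicate i A) A (2 - int i) (m i)"
      using m i by (simp add: ainf_algebra_def)
    have "replicate i A = replicate (i - 1) A @ [A]"
      using i by (metis Suc_pred' less_eq_Suc_le One_nat_def replicate_Suc replicate_append_same)
    then show "list_all2 (\<lambda>B A. \<forall>p. B p \<subseteq> A p) (replicate (i - 1) B @ [M]) (replicate i A)"
      using subB subM by (simp add: list_all2_append list_all2_replicate_right)
    fix xs assume xs: "list_all2 (\<lambda>x B. x \<in> homog B) xs (replicate (i - 1) B @ [M])"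
    then obtain ys y where y: "xs = ys @ [y]" "list_all2 (\<lambda>x B. x \<in> homog B) ys (replicate (i - 1) B)"
      "y \<in> homog M"
      by (auto simp: list_all2_append2 list_all2_Cons2)
    then have "length ys = i - 1" "set ys \<subseteq> homog B" by (auto simp: list_all2_replicate_right)
    then show "m i xs \<in> M (deg xs + (2 - int i))" using closed[of ys y] y i by auto
  qed
next
  fix n :: nat and xs :: "(int \<times> 'v) list" and y
  assume "1 \<le> n" "length xs = n - 1 \<and> set xs \<subseteq> homog B \<and> y \<in> homog M"
  then have "length (xs @ [y]) = n" "set (xs @ [y]) \<subseteq> homog A" "1 \<le> n"
    using homog_mono[of B A, OF subB] homog_mono[of M A, OF subM] by auto
  then show "(\<Sum>(r, s, t)\<in>{(r, s, t). r + s + t = n \<and> 1 \<le> s}.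
      stasheff_term scale m (if t = 0 then m else m) r s t (xs @ [y])) = 0"
    using m unfolding ainf_algebra_def if_cancel by blast
qed


section \<open>The Tate complex as a cyclic subalgebra acting on the components\<close>

theorem theorem4p10:
  fixes G :: "('g, 'b) monoid_scheme" and X :: "'g set"
  assumes "group G" and "finite (carrier G)"
    and "conj_reps G X"
    and Rivera_Wang: "cyclic_ainf_algebra (th_scale :: 'k::field \<Rightarrow> _) (th_space G) (th_op G) (th_pair G)"
  shows "complex_embedding tate_scale (tate_space G) (tate_diff G)
           (th_scale :: 'k \<Rightarrow> _) (th_space G) (th_diff G) (tate_iota G)
       \<and> (\<forall>p. (tate_image G p :: ('g, 'k) thvec set) = th_component G \<one>\<^bsub>G\<^esub> p)
       \<and> cyclic_ainf_subalgebra (th_scale :: 'k \<Rightarrow> _) (tate_image G) (th_space G) (th_op G) (th_pair G)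
       \<and> (\<forall>x\<in>X. ainf_module (th_scale :: 'k \<Rightarrow> _) (tate_image G) (th_op G) (th_component G x) (th_op G))"
proof -
  interpret group G by fact
  note fin = assms(2)
  have alg: "ainf_algebra (th_scale :: 'k \<Rightarrow> _) (th_space G) (th_op G)"
    and nd: "nondegenerate_pairing (th_scale :: 'k \<Rightarrow> _) (th_space G) (th_pair G)"
    using Rivera_Wang by (simp_all add: cyclic_ainf_algebra_def)
  have image: "tate_image G = (th_component G \<one>\<^bsub>G\<^esub> :: int \<Rightarrow> ('g, 'k) thvec set)"
    using tate_image_eq[OF fin] by blast
  have op_space: "th_op G (length xs) xs \<in> th_space G (deg xs + (2 - int (length xs)))"
    if "xs \<noteq> []" "set xs \<subseteq> homog (th_space G)" for xs :: "(int \<times> ('g, 'k) thvec) list"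
  proof -
    have "1 \<le> length xs" using that(1) by (cases xs) auto
    then have "graded_multilinear (th_scale :: 'k \<Rightarrow> _) (replicate (length xs) (th_space G)) (th_space G)
        (2 - int (length xs)) (th_op G (length xs))"
      using alg by (simp add: ainf_algebra_def)
    moreover have "list_all2 (\<lambda>x A. x \<in> homog A) xs (replicate (length xs) (th_space G))"
      using that(2) by (auto simp: list_all2_replicate_right)
    ultimately show ?thesis by (simp add: graded_multilinear_def)
  qed
  have sub: "th_component G x p \<subseteq> (th_space G p :: ('g, 'k) thvec set)" for x p
    by (rule component_subset)
  have hsub: "homog (th_component G x) \<subseteq> homog (th_space G :: int \<Rightarrow> ('g, 'k) thvec set)" for x
    by (rule homog_mono[OF sub])
  have closed: "th_op G (length xs + 1) (xs @ [y])
      \<in> th_component G x (deg (xs @ [y]) + (2 - int (length xs + 1)))"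
    if "x \<in> carrier G" "set xs \<subseteq> homog (th_component G \<one>\<^bsub>G\<^esub>)" "y \<in> homog (th_component G x)"
    for x y and xs :: "(int \<times> ('g, 'k) thvec) list"
    using th_op_component[OF that] op_space[of "xs @ [y]"] that(2,3) hsub by fastforce
  have graded: "graded_space (th_scale :: 'k \<Rightarrow> _) (th_component G x)" for x
    by (rule graded_space_restrict[of _ "th_space G"])
      (use alg in \<open>auto simp: ainf_algebra_def component_zero intro: component_lincomb\<close>)
  have alg1: "ainf_algebra (th_scale :: 'k \<Rightarrow> _) (th_component G \<one>\<^bsub>G\<^esub>) (th_op G)"
  proof (rule ainf_algebra_restrict[OF alg graded sub])
    fix xs :: "(int \<times> ('g, 'k) thvec) list"
    assume xs: "xs \<noteq> []" "set xs \<subseteq> homog (th_component G \<one>\<^bsub>G\<^esub>)"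
    then obtain ys y where "xs = ys @ [y]" by (cases xs rule: rev_cases) auto
    then show "th_op G (length xs) xs \<in> th_component G \<one>\<^bsub>G\<^esub> (deg xs + (2 - int (length xs)))"
      using closed[OF one_closed, of ys y] xs by simp
  qed
  have embedding: "complex_embedding tate_scale (tate_space G) (tate_diff G)
      (th_scale :: 'k \<Rightarrow> _) (th_space G) (th_diff G) (tate_iota G)"
  proof (rule tate_iota_embedding[OF fin])
    fix p and f :: "('g, 'k) thvec" assume "f \<in> th_space G p"
    then show "th_diff G p f \<in> th_space G (p + 1)"
      using op_space[of "[(p, f)]"] by (simp add: th_op_def deg_def homog_def)
  qed
  have cyclic: "cyclic_ainf_algebra (th_scale :: 'k \<Rightarrow> _) (th_component G \<one>\<^bsub>G\<^esub>) (th_op G) (th_pair G)"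
    using Rivera_Wang alg1 nondegenerate_pairing_component_one[OF fin nd] hsub[of "\<one>\<^bsub>G\<^esub>"]
    unfolding cyclic_ainf_algebra_def by (meson order_trans)
  have "ainf_module (th_scale :: 'k \<Rightarrow> _) (th_component G \<one>\<^bsub>G\<^esub>) (th_op G) (th_component G x) (th_op G)"
    if "x \<in> X" for x
  proof -
    have "x \<in> carrier G" using that assms(3) by (auto simp: conj_reps_def)
    then show ?thesis by (intro ainf_module_restrict[OF alg alg1 graded sub sub] closed)
  qed
  then show ?thesis
    using embedding cyclic Rivera_Wang sub by (simp add: image cyclic_ainf_subalgebra_def)
qed

end
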